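(* Let $p$ be a prime number, let $d \geq 2$, and let $f : \hat{\mathbb{C}}_p \rightarrow \hat{\mathbb{C}}_p$ be a polynomial map of degree $d$ over $\mathbb{C}_p$. Suppose that $f$ is immediately expanding, that is, the Julia set $\mathcal{J}(f)$ is non-empty and there exists $\lambda > 1$ such that $|f'(z)|_p \geq \lambda$ for every $z \in \mathcal{J}(f)$. Then $f$ is $J$-stable in $Poly_d(\mathbb{C}_p)$, that is, there exists a neighborhood $U$ of $f$ in $Poly_d(\mathbb{C}_p)$ such that for every $g \in U$ there exists a homeomorphism $h : \mathcal{J}(f) \rightarrow \mathcal{J}(g)$ with $h \circ f = g \circ h$ on $\mathcal{J}(f)$.
   Context: $\mathbb{C}_p$ is the field of $p$-adic complex numbers (the completion of the algebraic closure of the completion of $\mathbb{Q}$ with respect to the $p$-adic norm), with norm $|\cdot|_p$ extending the $p$-adic norm on $\mathbb{Q}$ normalized by $|p|_p = p^{-1}$. $\hat{\mathbb{C}}_p = \mathbb{C}_p \cup \{\infty\}$ is the projective line with the chordal metric $\rho_p(z,w) = \frac{|z-w|_p}{\max\{|z|_p,1\}\max\{|w|_p,1\}}$ for $z,w \in \mathbb{C}_p$, $\rho_p(z,\infty) = \frac{1}{\max\{|z|_p,1\}}$ for $z \in \mathbb{C}_p$, and $\rho_p(\infty,\infty)=0$. A polynomial map $f$ is extended to $\hat{\mathbb{C}}_p$ by $f(\infty)=\infty$. $f^n$ denotes the $n$-th iterate. The Fatou set $\mathcal{F}(f)$ is the largest open subset of $\hat{\mathbb{C}}_p$ on which the family $\{f^n\}_{n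 \in \mathbb{N}}$ is equicontinuous (at every point, with respect to $\rho_p$); the Julia set is $\mathcal{J}(f) = \hat{\mathbb{C}}_p \setminus \mathcal{F}(f)$. For polynomial maps $\infty \in \mathcal{F}(f)$ and $\mathcal{J}(f)$ is a bounded subset of $\mathbb{C}_p$. Julia sets carry the subspace topology. $Poly_d(\mathbb{C}_p)$ is the set of polynomial maps $a_d z^d + \cdots + a_0$ of degree $d$ over $\mathbb{C}_p$, with the topology of $\mathbb{C}_p^{\times} \times \mathbb{C}_p^{d}$ via the coefficients $(a_d, a_{d-1}, \dots, a_0)$, where $\mathbb{C}_p^\times = \mathbb{C}_p \setminus \{0\}$. *)

theory Defs
  imports "HOL-Analysis.Analysis" "HOL-Computational_Algebra.Computational_Algebra"
begin

definition padic_abs :: "nat \<Rightarrow> rat \<Rightarrow> real" where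
  "padic_abs p x =
     (if x = 0 then 0
      else real p powi (int (multiplicity (int p) (snd (quotient_of x)))
                        - int (multiplicity (int p) (fst (quotient_of x)))))"

definition norm_dist :: "('a::field \<Rightarrow> real) \<Rightarrow> 'a \<Rightarrow> 'a \<Rightarrow> real" where
  "norm_dist N x y = N (x - y)"

definition subfield_set :: "'a::field set \<Rightarrow> bool" where
  "subfield_set S \<longleftrightarrow> 0 \<in> S \<and> 1 \<in> S \<and>
     (\<forall>x\<in>S. \<forall>y\<in>S. x - y \<in> S \<and> x * y \<in> S) \<and> (\<forall>x\<in>S. inverse x \<in> S)"

definition completion_of :: "('a::field \<Rightarrow> real) \<Rightarrow> 'a set \<Rightarrow> 'a set \<Rightarrow> bool" where
  "completion_of N S T \<longleftrightarrow> subfield_set S \<and> subfield_set T \<and> S \<subseteq> T \<and>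
     Metric_space.mcomplete T (norm_dist N) \<and>
     Metric_space.mtopology T (norm_dist N) closure_of S = T"

definition algebraic_over :: "'a::field set \<Rightarrow> 'a \<Rightarrow> bool" where
  "algebraic_over S x \<longleftrightarrow> (\<exists>q. q \<noteq> 0 \<and> (\<forall>i. coeff q i \<in> S) \<and> poly q x = 0)"

definition algebraic_closure_of :: "'a::field set \<Rightarrow> 'a set \<Rightarrow> bool" where
  "algebraic_closure_of S T \<longleftrightarrow> subfield_set S \<and> subfield_set T \<and> S \<subseteq> T \<and>
     (\<forall>x\<in>T. algebraic_over S x) \<and>
     (\<forall>q. (\<forall>i. coeff q i \<in> T) \<and> degree q > 0 \<longrightarrow> (\<exists>x\<in>T. poly q x = 0))"

locale ultrametric_norm =
  fixes N :: "'a::field \<Rightarrow> real"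
  assumes N_nonneg: "0 \<le> N x"
    and N_eq_0_iff: "N x = 0 \<longleftrightarrow> x = 0"
    and N_mult: "N (x * y) = N x * N y"
    and N_ultra: "N (x + y) \<le> max (N x) (N y)"

text \<open>
  The completion of \<open>\<rat>\<close>, an algebraic closure of it and the completion of the latter are
  determined up to (isometric) isomorphism, so \<open>\<complex>\<^sub>p\<close> is described as a field \<open>'a\<close> with a norm
  that contains such a tower. Its bottom is the image of \<open>\<rat>\<close> under \<open>of_rat\<close>, and its top is
  all of \<open>'a\<close>.
\<close>

locale padic_complex_field = ultrametric_norm N
  for p :: nat and N :: "'a::field_char_0 \<Rightarrow> real" +
  assumes N_of_rat: "N (of_rat r) = padic_abs p r"
    and tower: "\<exists>Qp Qp_bar. completion_of N (range of_rat) Qp \<and>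
                  algebraic_closure_of Qp Qp_bar \<and> completion_of N Qp_bar UNIV"

datatype 'a proj_line = Fin 'a | Infty

fun chordal :: "('a::field \<Rightarrow> real) \<Rightarrow> 'a proj_line \<Rightarrow> 'a proj_line \<Rightarrow> real" where
  "chordal N (Fin z) (Fin w) = N (z - w) / (max (N z) 1 * max (N w) 1)"
| "chordal N (Fin z) Infty = 1 / max (N z) 1"
| "chordal N Infty (Fin w) = 1 / max (N w) 1"
| "chordal N Infty Infty = 0"

definition proj_topology :: "('a::field \<Rightarrow> real) \<Rightarrow> 'a proj_line topology" where
  "proj_topology N = Metric_space.mtopology UNIV (chordal N)"

fun poly_map :: "'a::field poly \<Rightarrow> 'a proj_line \<Rightarrow> 'a proj_line" where
  "poly_map f (Fin z) = Fin (poly f z)"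
| "poly_map f Infty = Infty"

definition iterates_equicontinuous_at ::
    "('a::field \<Rightarrow> real) \<Rightarrow> ('a proj_line \<Rightarrow> 'a proj_line) \<Rightarrow> 'a proj_line \<Rightarrow> bool" where
  "iterates_equicontinuous_at N F z \<longleftrightarrow>
     (\<forall>\<epsilon>>0. \<exists>\<delta>>0. \<forall>w. chordal N z w < \<delta> \<longrightarrow>
        (\<forall>n. chordal N ((F ^^ n) z) ((F ^^ n) w) < \<epsilon>))"

definition fatou :: "('a::field \<Rightarrow> real) \<Rightarrow> 'a poly \<Rightarrow> 'a proj_line set" where
  "fatou N f = \<Union>{U. openin (proj_topology N) U \<and>
                    (\<forall>z\<in>U. iterates_equicontinuous_at N (poly_map f) z)}"

definition julia :: "('a::field \<Rightarrow> real) \<Rightarrow> 'a poly \<Rightarrow> 'a proj_line set" where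
  "julia N f = UNIV - fatou N f"

text \<open>
  \<open>\<infinity>\<close> lies in the Fatou set of every polynomial map of degree at least 2, so the bound on the
  derivative is only stated at the finite points of the Julia set.
\<close>

definition immediately_expanding :: "('a::field \<Rightarrow> real) \<Rightarrow> 'a poly \<Rightarrow> bool" where
  "immediately_expanding N f \<longleftrightarrow> julia N f \<noteq> {} \<and>
     (\<exists>c>1. \<forall>z. Fin z \<in> julia N f \<longrightarrow> N (poly (pderiv f) z) \<ge> c)"

definition norm_topology :: "('a::field \<Rightarrow> real) \<Rightarrow> 'a topology" where
  "norm_topology N = Metric_space.mtopology UNIV (norm_dist N)"

text \<open>
  The polynomials of degree \<open>d\<close> with the topology that makes the coefficient map to
  \<open>K\<^sup>\<times> \<times> K\<^sup>d\<close> a homeomorphism. Points of this product are functions on \<open>{..d}\<close> extended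
  by \<open>undefined\<close>, and the factor with index \<open>d\<close> is \<open>K\<^sup>\<times>\<close>.
\<close>

definition poly_topology :: "('a::field \<Rightarrow> real) \<Rightarrow> nat \<Rightarrow> 'a poly topology" where
  "poly_topology N d =
     pullback_topology {f. degree f = d} (\<lambda>f. restrict (coeff f) {..d})
       (product_topology
          (\<lambda>i. if i = d then subtopology (norm_topology N) (UNIV - {0}) else norm_topology N)
          {..d})"

definition J_stable :: "('a::field \<Rightarrow> real) \<Rightarrow> nat \<Rightarrow> 'a poly \<Rightarrow> bool" where
  "J_stable N d f \<longleftrightarrow>
     (\<exists>U. openin (poly_topology N d) U \<and> f \<in> U \<and>
        (\<forall>g\<in>U. \<exists>h.
           homeomorphic_map (subtopology (proj_topology N) (julia N f))
                            (subtopology (proj_topology N) (julia N g)) h \<and>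
           (\<forall>z\<in>julia N f. h (poly_map f z) = poly_map g (h z))))"

context ultrametric_norm
begin

lemma N_0 [simp]: "N 0 = 0"
  by (simp add: N_eq_0_iff)

lemma N_1 [simp]: "N 1 = 1"
  using N_mult[of 1 1] N_eq_0_iff[of 1] by simp

lemma N_minus [simp]: "N (- x) = N x"
proof -
  have "N (-1) * N (-1) = 1"
    using N_mult[of "-1" "-1"] by simp
  then have "N (-1) = 1"
    using N_nonneg[of "-1"] by (metis abs_of_nonneg power2_eq_square real_sqrt_abs real_sqrt_one)
  then show ?thesis
    using N_mult[of "-1" x] by simp
qed

lemma N_diff_commute: "N (x - y) = N (y - x)"
  by (metis N_minus minus_diff_eq)

lemma N_diff_ultra: "N (x - z) \<le> max (N (x - y)) (N (y - z))"
  using N_ultra[of "x - y" "y - z"] by simp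

lemma N_diff_le: "N (x - y) \<le> max (N x) (N y)"
  using N_ultra[of x "- y"] by simp

lemma Metric_space_norm_dist: "Metric_space S (norm_dist N)"
proof
  show "0 \<le> norm_dist N x y" for x y
    by (simp add: norm_dist_def N_nonneg)
  show "norm_dist N x y = norm_dist N y x" for x y
    by (simp add: norm_dist_def N_diff_commute)
  show "norm_dist N x y = 0 \<longleftrightarrow> x = y" for x y
    by (simp add: norm_dist_def N_eq_0_iff)
  show "norm_dist N x z \<le> norm_dist N x y + norm_dist N y z" for x y z
    using N_diff_ultra[of x z y] N_nonneg[of "x - y"] N_nonneg[of "y - z"]
    by (simp add: norm_dist_def)
qed

lemma chordal_ultra: "chordal N a c \<le> max (chordal N a b) (chordal N b c)"
proof -
  define X where "X = (\<lambda>a::'a proj_line. case a of Fin z \<Rightarrow> z | Infty \<Rightarrow> 1)"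
  define Y where "Y = (\<lambda>a::'a proj_line. case a of Fin z \<Rightarrow> 1::'a | Infty \<Rightarrow> 0)"
  define m where "m = (\<lambda>a. max (N (X a)) (N (Y a)))"
  define D where "D = (\<lambda>a b. N (X a * Y b - X b * Y a))"
  have m_pos: "m a > 0" for a
    by (cases a) (simp_all add: m_def X_def Y_def less_max_iff_disj)
  have D_nonneg: "D a b \<ge> 0" for a b
    by (simp add: D_def N_nonneg)
  have ch: "chordal N a b = D a b / (m a * m b)" for a b
    using N_nonneg
    by (cases a; cases b) (simp_all add: D_def m_def X_def Y_def max_def)
  have gen: "N t * D a c \<le> max (m a * D b c) (m c * D a b)"
    if "t = X b \<and> u = X a \<and> v = X c \<or> t = Y b \<and> u = Y a \<and> v = Y c" for t u v
  proof -
    have "t * (X a * Y c - X c * Y a) =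
          u * (X b * Y c - X c * Y b) + v * (X a * Y b - X b * Y a)"
      using that by (elim disjE conjE; simp add: algebra_simps)
    then have "N t * D a c \<le> max (N u * D b c) (N v * D a b)"
      unfolding D_def by (metis N_mult N_ultra)
    also have "N u * D b c \<le> m a * D b c"
      using that D_nonneg by (intro mult_right_mono) (auto simp: m_def)
    moreover have "N v * D a b \<le> m c * D a b"
      using that D_nonneg by (intro mult_right_mono) (auto simp: m_def)
    ultimately show ?thesis
      by linarith
  qed
  have "m b * D a c \<le> max (m a * D b c) (m c * D a b)"
    using gen[of "X b" "X a" "X c"] gen[of "Y b" "Y a" "Y c"]
    by (cases "N (X b) \<le> N (Y b)") (simp_all add: m_def[of] max_def)
  then have "m b * D a c / (m a * m b * m c) \<le>
      max (m a * D b c) (m c * D a b) / (m a * m b * m c)"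
    using m_pos[of a] m_pos[of b] m_pos[of c] by (intro divide_right_mono) auto
  also have "\<dots> = max (D b c / (m b * m c)) (D a b / (m a * m b))"
    using m_pos[of a] m_pos[of b] m_pos[of c]
    by (auto simp: max_def field_simps)
  also have "m b * D a c / (m a * m b * m c) = D a c / (m a * m c)"
    using m_pos[of b] by simp
  finally show ?thesis
    by (simp add: ch max.commute)
qed

lemma Metric_space_chordal: "Metric_space UNIV (chordal N)"
proof
  show "0 \<le> chordal N a b" for a b
    by (cases a; cases b) (simp_all add: N_nonneg)
  then show "chordal N a c \<le> chordal N a b + chordal N b c" for a b c
    using chordal_ultra[of a c b] by (smt (verit))
  show "chordal N a b = chordal N b a" for a b
    by (cases a; cases b) (simp_all add: N_diff_commute mult.commute)
  have "max (N z) 1 \<noteq> 0" for z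
    by (simp add: max_def)
  then show "chordal N a b = 0 \<longleftrightarrow> a = b" for a b
    by (cases a; cases b) (simp_all add: N_eq_0_iff)
qed

end

end

(*
  Let g be a polynomial near f. By Taylor expansion there is a radius r such that f and g both scale
  every disk D(z, r) with z in J(f) by the factor |f'(z)|, which exceeds 1. Hence every f-orbit in
  J(f) is shadowed within r by exactly one g-orbit. The resulting map h conjugates f to g, is an
  isometry by the ultrametric inequality, and its values lie in J(g) because g is expanding along
  the shadowing orbits.

  For surjectivity, the nearest root c of f - z to a point x satisfies
  |f'(c)| |x - c| <= |f(x) - z|, and c lies in J(f) if z does. Pulling a point of J(f) back along a
  bounded g-orbit in this way contracts the distance to the orbit, so every point of J(g) is
  shadowed by a point of J(f). This uses that the field is algebraically closed and complete, but
  no compactness of J(f).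
*)

theory Submission
  imports Defs
begin

text \<open>The radius r and the neighbourhood do not depend on the expansion constant. J(f) lies in
  a disk D(0, R) read off from the coefficients, and r is chosen so that the linear approximation on
  D(z, r) has error at most |u - v|. Any lower bound above 1 for |f'(z)| makes the linear term
  strictly dominant, and a strictly dominant term determines the norm of an ultrametric sum. So the
  estimate becomes an equality, with room for replacing f' by g', and f and g get exactly the same
  factor. This is why the conjugacy is an isometry and not merely close to the identity.

  That a shadowing point lies in J(g) follows from uniqueness: equicontinuity there would give
  further points shadowing the same orbit. This needs elements of arbitrarily small nonzero norm.

  The tower only provides a dense algebraically closed subfield, so the existence of roots in the
  whole field has to be derived. The nearest-root estimates serve here too, since they control how
  roots move when a polynomial is approximated.\<close>

section \<open>Polynomials over ultrametric fields\<close>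

context ultrametric_norm
begin

lemma N_power: "N (x ^ n) = N x ^ n"
  by (induction n) (simp_all add: N_mult)

lemma N_pos: "x \<noteq> 0 \<Longrightarrow> N x > 0"
  using N_nonneg[of x] N_eq_0_iff[of x] by linarith

lemma N_add_eq: "N (x + y) = N x" if "N y < N x"
  using that N_ultra[of x y] N_diff_le[of "x + y" y] by simp

lemma N_eq_of_diff_less: "N x = N y" if "N (x - y) < N y"
  using N_add_eq[OF that] by simp

lemma N_le_of_diff_le: "N x \<le> c" if "N (x - y) \<le> c" "N y \<le> c"
  using N_ultra[of "x - y" y] that by simp

lemma N_diff_le_trans: "N (x - z) \<le> c" if "N (x - y) \<le> c" "N (y - z) \<le> c"
  using N_diff_ultra[of x z y] that by simp

text \<open>The Gauss norm of \<open>q\<close> on the closed disk of radius \<open>\<rho>\<close> is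
  at most \<open>M\<close>. The estimates below are Cauchy estimates for this norm, cleared of
  denominators and proved by induction along Horner's scheme.\<close>

definition coeffs_le :: "real \<Rightarrow> real \<Rightarrow> 'a poly \<Rightarrow> bool" where
  "coeffs_le \<rho> M q \<longleftrightarrow> (\<forall>i. N (coeff q i) * \<rho> ^ i \<le> M)"

lemma coeffs_le_nonneg: "coeffs_le \<rho> M q \<Longrightarrow> 0 \<le> M"
  unfolding coeffs_le_def using N_nonneg[of "coeff q 0"] by (metis mult.right_neutral order_trans power_0)

lemma coeffs_le_pCons:
  assumes "0 < \<rho>" "coeffs_le \<rho> M (pCons a q)"
  shows "N a \<le> M" "coeffs_le \<rho> (M / \<rho>) q"
proof -
  show "N a \<le> M"
    using assms(2) unfolding coeffs_le_def by (metis coeff_pCons_0 mult.right_neutral power_0)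
  have "N (coeff q i) * \<rho> ^ i * \<rho> \<le> M" for i
    using assms(2)[unfolded coeffs_le_def, rule_format, of "Suc i"] by (simp add: ac_simps)
  then show "coeffs_le \<rho> (M / \<rho>) q"
    using assms(1) by (simp add: coeffs_le_def pos_le_divide_eq)
qed

lemma coeffs_le_exists:
  obtains M where "coeffs_le \<rho> M q"
proof -
  have "coeffs_le \<rho> (\<Sum>i\<le>degree q. N (coeff q i) * \<bar>\<rho>\<bar> ^ i) q"
    unfolding coeffs_le_def
  proof
    fix i
    have nonneg: "0 \<le> N (coeff q j) * \<bar>\<rho>\<bar> ^ j" for j
      by (simp add: N_nonneg)
    show "N (coeff q i) * \<rho> ^ i \<le> (\<Sum>i\<le>degree q. N (coeff q i) * \<bar>\<rho>\<bar> ^ i)"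
    proof (cases "i \<le> degree q")
      case True
      have "N (coeff q i) * \<rho> ^ i \<le> N (coeff q i) * \<bar>\<rho>\<bar> ^ i"
        by (intro mult_left_mono) (auto simp: N_nonneg simp flip: power_abs)
      also have "\<dots> \<le> (\<Sum>i\<le>degree q. N (coeff q i) * \<bar>\<rho>\<bar> ^ i)"
        using True nonneg by (intro member_le_sum) auto
      finally show ?thesis .
    next
      case False
      then show ?thesis
        by (simp add: coeff_eq_0 sum_nonneg nonneg)
    qed
  qed
  then show thesis ..
qed

lemma coeffs_leI:
  assumes "degree q \<le> n" "1 \<le> \<rho>" "\<And>i. N (coeff q i) \<le> B"
  shows "coeffs_le \<rho> (B * \<rho> ^ n) q"
  unfolding coeffs_le_def
proof
  fix i
  have B: "0 \<le> B"
    using assms(3)[of 0] N_nonneg[of "coeff q 0"] by linarith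
  show "N (coeff q i) * \<rho> ^ i \<le> B * \<rho> ^ n"
  proof (cases "i \<le> n")
    case True
    then show ?thesis
      using assms B by (intro mult_mono power_increasing) auto
  next
    case False
    then show ?thesis
      using assms B by (simp add: coeff_eq_0)
  qed
qed

lemma N_poly_le:
  assumes "0 < \<rho>" "coeffs_le \<rho> M q" "N x \<le> \<rho>"
  shows "N (poly q x) \<le> M"
  using assms(2)
proof (induction q arbitrary: M)
  case 0
  then show ?case
    by (simp add: coeffs_le_nonneg)
next
  case (pCons a q)
  note tail = coeffs_le_pCons[OF assms(1) pCons.prems]
  have "N x * N (poly q x) \<le> \<rho> * (M / \<rho>)"
    using pCons.IH[OF tail(2)] assms N_nonneg by (intro mult_mono) auto
  then show ?case
    using tail(1) N_ultra[of a "x * poly q x"] assms(1) by (simp add: N_mult)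
qed

lemma N_poly_diff_le:
  assumes "0 < \<rho>" "coeffs_le \<rho> M q" "N x \<le> \<rho>" "N y \<le> \<rho>"
  shows "\<rho> * N (poly q x - poly q y) \<le> M * N (x - y)"
  using assms(2)
proof (induction q arbitrary: M)
  case 0
  then show ?case
    by (simp add: coeffs_le_nonneg N_nonneg)
next
  case (pCons a q)
  note tail = coeffs_le_pCons[OF assms(1) pCons.prems]
  have "\<rho> * N (poly q x - poly q y) \<le> M / \<rho> * N (x - y)"
    by (rule pCons.IH[OF tail(2)])
  then have "N x * (\<rho> * N (poly q x - poly q y)) \<le> \<rho> * (M / \<rho> * N (x - y))"
    by (rule mult_mono[OF assms(3)]) (use assms(1) N_nonneg in auto)
  then have 1: "\<rho> * N (x * (poly q x - poly q y)) \<le> M * N (x - y)"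
    using assms(1) by (simp add: N_mult ac_simps)
  have "N (poly q y) \<le> M / \<rho>"
    using N_poly_le[OF assms(1) tail(2) assms(4)] .
  then have "N (x - y) * (N (poly q y) * \<rho>) \<le> N (x - y) * M"
    using assms(1) N_nonneg by (intro mult_left_mono) (auto simp: pos_le_divide_eq)
  then have 2: "\<rho> * N ((x - y) * poly q y) \<le> M * N (x - y)"
    by (simp add: N_mult ac_simps)
  have "poly (pCons a q) x - poly (pCons a q) y
      = x * (poly q x - poly q y) + (x - y) * poly q y"
    by (simp add: algebra_simps)
  then have "N (poly (pCons a q) x - poly (pCons a q) y)
      \<le> max (N (x * (poly q x - poly q y))) (N ((x - y) * poly q y))"
    by (metis N_ultra)
  then show ?case
    using 1 2 assms(1) by (smt (verit) mult_left_mono)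
qed

lemma N_pderiv_le:
  assumes "0 < \<rho>" "coeffs_le \<rho> M q" "N x \<le> \<rho>"
  shows "\<rho> * N (poly (pderiv q) x) \<le> M"
  using assms(2)
proof (induction q arbitrary: M)
  case 0
  then show ?case
    by (simp add: coeffs_le_nonneg)
next
  case (pCons a q)
  note tail = coeffs_le_pCons[OF assms(1) pCons.prems]
  have 1: "\<rho> * N (poly q x) \<le> M"
    using N_poly_le[OF assms(1) tail(2) assms(3)] assms(1)
    by (simp add: pos_le_divide_eq mult.commute)
  have "N x * (\<rho> * N (poly (pderiv q) x)) \<le> \<rho> * (M / \<rho>)"
    using pCons.IH[OF tail(2)] assms N_nonneg by (intro mult_mono) auto
  then have 2: "\<rho> * N (x * poly (pderiv q) x) \<le> M"
    using assms(1) by (simp add: N_mult ac_simps)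
  have "N (poly (pderiv (pCons a q)) x) \<le> max (N (poly q x)) (N (x * poly (pderiv q) x))"
    using N_ultra by (simp add: pderiv_pCons)
  then show ?case
    using 1 2 assms(1) by (smt (verit) mult_left_mono)
qed

text \<open>The derivative is taken at a centre \<open>z\<close>, not at \<open>x\<close> or
  \<open>y\<close>, so that one linear factor serves all pairs of points in a disk around
  \<open>z\<close>. The gain over the Lipschitz bound is the factor
  \<open>s / \<rho>\<close>.\<close>

lemma N_poly_taylor_le:
  assumes "0 < \<rho>" "coeffs_le \<rho> M q" "N x \<le> \<rho>" "N y \<le> \<rho>" "N z \<le> \<rho>"
    and "N (x - z) \<le> s" "N (y - z) \<le> s"
  shows "\<rho>\<^sup>2 * N (poly q x - poly q y - (x - y) * poly (pderiv q) z) \<le> M * N (x - y) * s"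
  using assms(2)
proof (induction q arbitrary: M)
  case 0
  then show ?case
    using order_trans[OF N_nonneg assms(6)] by (simp add: coeffs_le_nonneg N_nonneg)
next
  case (pCons a q)
  note tail = coeffs_le_pCons[OF assms(1) pCons.prems]
  define t where "t = poly q x - poly q y - (x - y) * poly (pderiv q) z"
  \<comment> \<open>Horner's scheme splits the remainder for \<open>pCons a q\<close> into
    \<open>x * t\<close>, with \<open>t\<close> the remainder for \<open>q\<close>, and
    \<open>(x - y) * u\<close>, where \<open>u\<close> is already of order \<open>s\<close>.\<close>
  define u where "u = (poly q y - poly q z) + (x - z) * poly (pderiv q) z"
  have "N x * (\<rho>\<^sup>2 * N t) \<le> \<rho> * (M / \<rho> * N (x - y) * s)"
    unfolding t_def by (rule mult_mono[OF assms(3) pCons.IH[OF tail(2)]])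
      (use assms(1) N_nonneg in auto)
  then have 1: "\<rho>\<^sup>2 * N (x * t) \<le> M * N (x - y) * s"
    using assms(1) by (simp add: N_mult ac_simps)
  have M: "0 \<le> M / \<rho>"
    using coeffs_le_nonneg[OF tail(2)] .
  have "\<rho> * N (poly q y - poly q z) \<le> M / \<rho> * N (y - z)"
    by (rule N_poly_diff_le[OF assms(1) tail(2) assms(4,5)])
  also have "\<dots> \<le> M / \<rho> * s"
    using assms(7) M by (rule mult_left_mono)
  finally have u1: "\<rho> * N (poly q y - poly q z) \<le> M / \<rho> * s" .
  have "N (x - z) * (\<rho> * N (poly (pderiv q) z)) \<le> s * (M / \<rho>)"
    using N_pderiv_le[OF assms(1) tail(2) assms(5)] assms(1,6) N_nonneg
      order_trans[OF N_nonneg assms(6)]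
    by (intro mult_mono) auto
  then have u2: "\<rho> * N ((x - z) * poly (pderiv q) z) \<le> M / \<rho> * s"
    by (simp add: N_mult ac_simps)
  have "N u \<le> max (N (poly q y - poly q z)) (N ((x - z) * poly (pderiv q) z))"
    unfolding u_def by (rule N_ultra)
  then have "\<rho> * N u \<le> M / \<rho> * s"
    using u1 u2 assms(1) by (smt (verit) mult_left_mono)
  then have "\<rho> * N (x - y) * (\<rho> * N u) \<le> \<rho> * N (x - y) * (M / \<rho> * s)"
    using assms(1) N_nonneg by (intro mult_left_mono) auto
  then have 2: "\<rho>\<^sup>2 * N ((x - y) * u) \<le> M * N (x - y) * s"
    using assms(1) by (simp add: N_mult power2_eq_square ac_simps)
  have "poly (pCons a q) x - poly (pCons a q) y - (x - y) * poly (pderiv (pCons a q)) z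
      = x * t + (x - y) * u"
    by (simp add: pderiv_pCons t_def u_def algebra_simps)
  then have "N (poly (pCons a q) x - poly (pCons a q) y - (x - y) * poly (pderiv (pCons a q)) z)
      \<le> max (N (x * t)) (N ((x - y) * u))"
    by (metis N_ultra)
  then show ?case
    using 1 2 zero_le_power2[of \<rho>] by (smt (verit) mult_left_mono)
qed

end

section \<open>Nearest roots\<close>

lemma subfield_set_poly:
  assumes "subfield_set T" "\<And>i. coeff q i \<in> T" "c \<in> T"
  shows "poly q c \<in> T"
  using assms(2)
proof (induction q)
  case 0
  then show ?case
    using assms(1) by (simp add: subfield_set_def)
next
  case (pCons a q)
  have "coeff q i \<in> T" for i
    using pCons.prems[of "Suc i"] by simp
  then have "c * poly q c \<in> T"
    using pCons.IH assms(1,3) by (auto simp: subfield_set_def)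
  moreover have "a \<in> T"
    using pCons.prems[of 0] by simp
  ultimately have "a - (0 - c * poly q c) \<in> T"
    using assms(1) unfolding subfield_set_def by blast
  then show ?case
    by simp
qed

lemma subfield_set_synthetic_div:
  assumes "subfield_set T" "\<And>i. coeff q i \<in> T" "c \<in> T"
  shows "coeff (synthetic_div q c) i \<in> T"
  using assms(2)
proof (induction q arbitrary: i)
  case 0
  then show ?case
    using assms(1) by (simp add: subfield_set_def)
next
  case (pCons a q)
  have "coeff q i \<in> T" for i
    using pCons.prems[of "Suc i"] by simp
  then show ?case
    using pCons.IH subfield_set_poly[OF assms(1) _ assms(3)] by (cases i) auto
qed

context ultrametric_norm
begin

context
  fixes T :: "'a set"
  assumes subfield: "subfield_set T"
    and root: "\<forall>q. (\<forall>i. coeff q i \<in> T) \<and> degree q > 0 \<longrightarrow> (\<exists>x\<in>T. poly q x = 0)"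
begin

text \<open>Synthetic division stays inside \<open>T\<close>, so an induction on the degree finds
  its next root in \<open>T\<close> again.\<close>

lemma root_factor:
  assumes "\<And>i. coeff q i \<in> T" "c \<in> T" "poly q c = 0" "degree q > 0"
  obtains q' where "q = [:- c, 1:] * q'" "\<And>i. coeff q' i \<in> T" "degree q = Suc (degree q')"
    "q' \<noteq> 0" "lead_coeff q' = lead_coeff q"
proof
  let ?q = "synthetic_div q c"
  show eq: "q = [:- c, 1:] * ?q"
    using synthetic_div_correct'[of c q] assms(3) by simp
  show "coeff ?q i \<in> T" for i
    by (rule subfield_set_synthetic_div[OF subfield assms(1,2)])
  show nz: "?q \<noteq> 0"
    using assms(4) eq by (metis degree_0 less_irrefl mult_zero_right)
  have "degree q = degree [:- c, 1:] + degree ?q"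
    by (subst eq, rule degree_mult_eq) (use nz in auto)
  then show "degree q = Suc (degree ?q)"
    by simp
  show "lead_coeff ?q = lead_coeff q"
    by (subst (3 4) eq, subst lead_coeff_mult) simp
qed

text \<open>Split \<open>q\<close> into linear factors; \<open>\<rho>\<close> bounds every |x - c|
  from below. The product gives the first bound, the logarithmic derivative, a sum of terms 1 / (x -
  c), the second, and |y - c| \<le> |x - c| for every root the third. The point \<open>x\<close>
  need not lie in \<open>T\<close>.\<close>

lemma root_distance_bounds:
  assumes "\<And>i. coeff q i \<in> T" "q \<noteq> 0" "0 \<le> \<rho>"
    and "\<And>c. c \<in> T \<Longrightarrow> poly q c = 0 \<Longrightarrow> \<rho> \<le> N (x - c)"
  shows "N (lead_coeff q) * \<rho> ^ degree q \<le> N (poly q x)"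
    and "\<rho> * N (poly (pderiv q) x) \<le> N (poly q x)"
    and "N (x - y) \<le> \<rho> \<Longrightarrow> N (poly q y) \<le> N (poly q x)"
proof -
  have "N (lead_coeff q) * \<rho> ^ degree q \<le> N (poly q x) \<and>
      \<rho> * N (poly (pderiv q) x) \<le> N (poly q x) \<and>
      (N (x - y) \<le> \<rho> \<longrightarrow> N (poly q y) \<le> N (poly q x))"
    using assms(1,2,4)
  proof (induction "degree q" arbitrary: q)
    case 0
    then obtain a where "q = [:a:]"
      by (metis degree_eq_zeroE)
    then show ?case
      by (simp add: pderiv_pCons N_nonneg)
  next
    case (Suc n)
    obtain c where c: "c \<in> T" "poly q c = 0"
      using root[rule_format, of q] Suc.prems(1) Suc.hyps(2) by auto
    obtain q' where q': "q = [:- c, 1:] * q'" "\<And>i. coeff q' i \<in> T"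
      "degree q = Suc (degree q')" "q' \<noteq> 0" "lead_coeff q' = lead_coeff q"
      by (rule root_factor[of q c]) (use Suc c in auto)
    have IH: "N (lead_coeff q') * \<rho> ^ degree q' \<le> N (poly q' x)"
        "\<rho> * N (poly (pderiv q') x) \<le> N (poly q' x)"
        "N (x - y) \<le> \<rho> \<Longrightarrow> N (poly q' y) \<le> N (poly q' x)"
      using Suc.hyps(1)[of q'] Suc.hyps(2) Suc.prems(3) q' by auto
    have rho: "\<rho> \<le> N (x - c)"
      using Suc.prems(3) c .
    have ev: "poly q t = (t - c) * poly q' t" for t
      by (subst q'(1)) (simp add: algebra_simps)
    have ev': "poly (pderiv q) x = poly q' x + (x - c) * poly (pderiv q') x"
      by (subst q'(1), subst pderiv_mult) (simp add: pderiv_pCons algebra_simps)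
    have "\<rho> * (N (lead_coeff q') * \<rho> ^ degree q') \<le> N (x - c) * N (poly q' x)"
      using IH(1) rho assms(3) N_nonneg by (intro mult_mono) auto
    then have 1: "N (lead_coeff q) * \<rho> ^ degree q \<le> N (poly q x)"
      by (simp add: ev q'(3,5) N_mult ac_simps)
    have "\<rho> * N (poly q' x) \<le> N (poly q x)"
      using rho by (simp add: ev N_mult N_nonneg mult_right_mono)
    moreover have "\<rho> * N ((x - c) * poly (pderiv q') x) \<le> N (poly q x)"
      using mult_left_mono[OF IH(2) N_nonneg[of "x - c"]] by (simp add: ev N_mult ac_simps)
    moreover have "\<rho> * N (poly (pderiv q) x)
        \<le> \<rho> * max (N (poly q' x)) (N ((x - c) * poly (pderiv q') x))"
      unfolding ev' using assms(3) N_ultra by (intro mult_left_mono) auto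
    ultimately have 2: "\<rho> * N (poly (pderiv q) x) \<le> N (poly q x)"
      by (auto simp: max_def split: if_splits)
    have 3: "N (poly q y) \<le> N (poly q x)" if y: "N (x - y) \<le> \<rho>"
    proof -
      have "N (y - c) \<le> N (x - c)"
        using N_diff_ultra[of y c x] y rho by (simp add: N_diff_commute)
      then show ?thesis
        using IH(3)[OF y] by (simp add: ev N_mult N_nonneg mult_mono)
    qed
    show ?case
      using 1 2 3 by blast
  qed
  then show "N (lead_coeff q) * \<rho> ^ degree q \<le> N (poly q x)"
    and "\<rho> * N (poly (pderiv q) x) \<le> N (poly q x)"
    and "N (x - y) \<le> \<rho> \<Longrightarrow> N (poly q y) \<le> N (poly q x)"
    by auto
qed

text \<open>The bound with the derivative at the root comes from dividing the root out: with
  \<open>q = [:- c, 1:] * q'\<close>, the derivative of \<open>q\<close> at \<open>c\<close> is the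
  value of \<open>q'\<close> at \<open>c\<close>. Roots of \<open>q'\<close> are roots of
  \<open>q\<close>, hence no closer to \<open>x\<close> than \<open>c\<close>, so the third bound of
  \<open>root_distance_bounds\<close> compares \<open>q'\<close> at \<open>c\<close> with
  \<open>q'\<close> at \<open>x\<close>.\<close>

lemma nearest_root:
  assumes "\<And>i. coeff q i \<in> T" "degree q > 0"
  obtains c where "c \<in> T" "poly q c = 0"
    "N (lead_coeff q) * N (x - c) ^ degree q \<le> N (poly q x)"
    "N (x - c) * N (poly (pderiv q) x) \<le> N (poly q x)"
    "N (x - c) * N (poly (pderiv q) c) \<le> N (poly q x)"
proof -
  define Z where "Z = {c \<in> T. poly q c = 0}"
  have "q \<noteq> 0"
    using assms(2) by auto
  then have "finite Z"
    using poly_roots_finite[of q] by (simp add: Z_def)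
  moreover have "Z \<noteq> {}"
    using root assms by (auto simp: Z_def)
  ultimately obtain c where cZ: "c \<in> Z" and min: "\<And>c'. c' \<in> Z \<Longrightarrow> N (x - c) \<le> N (x - c')"
    by (meson arg_min_if_finite(1) arg_min_least)
  have c: "c \<in> T" "poly q c = 0"
    using cZ by (auto simp: Z_def)
  obtain q' where q': "q = [:- c, 1:] * q'" "\<And>i. coeff q' i \<in> T" "q' \<noteq> 0"
    by (rule root_factor[of q c]) (use assms c in auto)
  have "c' \<in> Z" if "c' \<in> T" "poly q' c' = 0" for c'
    unfolding Z_def using that by (subst q'(1)) simp
  then have "N (poly q' c) \<le> N (poly q' x)"
    using min by (intro root_distance_bounds(3)[where \<rho> = "N (x - c)"] q'(2,3) N_nonneg) auto
  then have "N (x - c) * N (poly q' c) \<le> N (x - c) * N (poly q' x)"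
    by (rule mult_left_mono) (rule N_nonneg)
  also have "N (x - c) * N (poly q' x) = N (poly q x)"
    by (subst q'(1)) (simp add: N_mult[symmetric] algebra_simps)
  also have "poly q' c = poly (pderiv q) c"
    by (subst q'(1), subst pderiv_mult) (simp add: pderiv_pCons)
  finally show thesis
    using that[of c] c min \<open>q \<noteq> 0\<close> assms(1)
      root_distance_bounds[where \<rho> = "N (x - c)" and q = q] by (auto simp: Z_def N_nonneg)
qed

end

section \<open>Algebraic closedness of the completion\<close>

lemma geometric_limit:
  assumes "Metric_space.mcomplete UNIV (norm_dist N)"
    and "0 \<le> b" "b < 1" "\<And>n. N (x (Suc n) - x n) \<le> C * b ^ n"
  obtains l where "\<And>n. N (l - x n) \<le> C * b ^ n"
proof -
  interpret Metric_space UNIV "norm_dist N"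
    by (rule Metric_space_norm_dist)
  have C: "0 \<le> C"
    using assms(4)[of 0] N_nonneg[of "x (Suc 0) - x 0"] by simp
  \<comment> \<open>The largest of several steps bounds their sum, so no factor 1 / (1 - b)
    appears.\<close>
  have step: "N (x (n + k) - x n) \<le> C * b ^ n" for n k
  proof (induction k)
    case 0
    then show ?case
      using C assms(2) by simp
  next
    case (Suc k)
    have "C * b ^ (n + k) \<le> C * b ^ n"
      using C assms(2,3) by (intro mult_left_mono power_decreasing) auto
    then have "N (x (n + Suc k) - x (n + k)) \<le> C * b ^ n"
      using assms(4)[of "n + k"] by simp
    then show ?case
      using Suc.IH by (rule N_diff_le_trans)
  qed
  have lim: "(\<lambda>n. C * b ^ n) \<longlonglongrightarrow> 0"
    using assms(2,3) by (intro tendsto_mult_right_zero LIMSEQ_power_zero) auto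
  have "MCauchy x"
    unfolding MCauchy_def
  proof (intro conjI allI impI)
    fix \<epsilon> :: real
    assume "0 < \<epsilon>"
    then have "\<forall>\<^sub>F n in sequentially. C * b ^ n < \<epsilon>"
      using lim order_tendstoD(2) by blast
    then obtain K where K: "C * b ^ K < \<epsilon>"
      by (auto simp: eventually_sequentially)
    have "norm_dist N (x n) (x m) < \<epsilon>" if "K \<le> n" "K \<le> m" for n m
    proof -
      have "N (x n - x K) \<le> C * b ^ K" "N (x m - x K) \<le> C * b ^ K"
        using step[of K "n - K"] step[of K "m - K"] that by auto
      then have "N (x n - x m) \<le> C * b ^ K"
        by (metis N_diff_commute N_diff_le_trans)
      then show ?thesis
        using K by (simp add: norm_dist_def)
    qed
    then show "\<exists>K. \<forall>n m. K \<le> n \<longrightarrow> K \<le> m \<longrightarrow> norm_dist N (x n) (x m) < \<epsilon>"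
      by blast
  qed auto
  then obtain l where l: "limitin mtopology x l sequentially"
    using assms(1) by (auto simp: mcomplete_def)
  have "N (l - x n) \<le> C * b ^ n" for n
  proof (rule field_le_epsilon)
    fix \<epsilon> :: real
    assume "0 < \<epsilon>"
    then have "\<forall>\<^sub>F m in sequentially. norm_dist N (x m) l < \<epsilon>"
      using l by (simp add: limitin_metric)
    then obtain K where "\<And>m. K \<le> m \<Longrightarrow> norm_dist N (x m) l < \<epsilon>"
      by (auto simp: eventually_sequentially)
    then have "N (l - x (n + K)) < \<epsilon>"
      by (metis N_diff_commute le_add2 norm_dist_def)
    moreover have "0 \<le> C * b ^ n"
      using C assms(2) by simp
    ultimately show "N (l - x n) \<le> C * b ^ n + \<epsilon>"
      using step[of n K] N_diff_ultra[of l "x n" "x (n + K)"] \<open>0 < \<epsilon>\<close> by linarith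
  qed
  then show thesis ..
qed

lemma poly_approximation:
  assumes dense: "\<forall>x. \<forall>e>0. \<exists>y\<in>T. N (x - y) < e" and "0 \<in> T" "0 < e"
  obtains Q where "\<And>i. coeff Q i \<in> T" "degree Q \<le> degree P" "\<And>i. N (coeff (P - Q) i) < e"
proof -
  have "\<exists>Q. (\<forall>i. coeff Q i \<in> T) \<and> degree Q \<le> degree P \<and> (\<forall>i. N (coeff (P - Q) i) < e)"
  proof (induction P)
    case 0
    then show ?case
      using assms(2,3) by (intro exI[of _ 0]) simp
  next
    case (pCons a P)
    then obtain Q where Q: "\<And>i. coeff Q i \<in> T" "degree Q \<le> degree P"
      "\<And>i. N (coeff (P - Q) i) < e"
      by blast
    obtain b where b: "b \<in> T" "N (a - b) < e"
      using dense assms(3) by blast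
    show ?case
    proof (cases "P = 0")
      case True
      then show ?thesis
        using b assms(2,3) by (intro exI[of _ "[:b:]"]) (auto simp: coeff_pCons split: nat.split)
    next
      case False
      then show ?thesis
        using b Q by (intro exI[of _ "pCons b Q"]) (auto simp: coeff_pCons split: nat.split)
    qed
  qed
  then show thesis
    using that by blast
qed

text \<open>A polynomial \<open>Q\<close> over \<open>T\<close> close to \<open>P\<close> has roots
  in \<open>T\<close>; the one nearest to \<open>x\<close> almost solves \<open>P\<close>, at a
  distance from \<open>x\<close> controlled by |P(x)|. This allows an iteration towards a root of
  \<open>P\<close>.\<close>

lemma approximate_root:
  assumes "subfield_set T"
    and root: "\<forall>q. (\<forall>i. coeff q i \<in> T) \<and> degree q > 0 \<longrightarrow> (\<exists>x\<in>T. poly q x = 0)"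
    and dense: "\<forall>x. \<forall>e>0. \<exists>y\<in>T. N (x - y) < e"
    and "degree P > 0" "0 < e"
  obtains c where "N (poly P c) \<le> e"
    "N (lead_coeff P) * N (x - c) ^ degree P \<le> max (N (poly P x)) e"
proof -
  define m where "m = degree P"
  define a where "a = N (lead_coeff P)"
  have a: "0 < a"
    unfolding a_def by (rule N_pos) (use assms(4) in auto)
  \<comment> \<open>\<open>B\<close> bounds |x - c|^m for the root \<open>c\<close> still to be
    found, so a disk of radius \<open>\<rho>\<close> containing \<open>x\<close> and
    \<open>c\<close> is fixed before \<open>Q\<close> is chosen.\<close>
  define B where "B = max (N (poly P x)) e / a"
  define \<rho> where "\<rho> = max 1 (max (N x) B)"
  have \<rho>: "1 \<le> \<rho>" "N x \<le> \<rho>" "B \<le> \<rho>"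
    by (auto simp: \<rho>_def)
  \<comment> \<open>The bound \<open>a\<close> preserves the norm of the leading coefficient, hence
    the degree; \<open>e / \<rho> ^ m\<close> gives |P - Q| \<le> e on the disk.\<close>
  define \<delta> where "\<delta> = min a (e / \<rho> ^ m)"
  have \<delta>: "0 < \<delta>" "\<delta> \<le> a" "\<delta> * \<rho> ^ m \<le> e"
    using a \<rho>(1) assms(5) by (auto simp: \<delta>_def min_def field_simps)
  obtain Q where Q: "\<And>i. coeff Q i \<in> T" "degree Q \<le> degree P" "\<And>i. N (coeff (P - Q) i) < \<delta>"
    by (rule poly_approximation[OF dense _ \<delta>(1)]) (use assms(1) in \<open>auto simp: subfield_set_def\<close>)
  have lead: "N (coeff Q m) = a"
    using N_eq_of_diff_less[of "coeff Q m" "coeff P m"] Q(3)[of m] \<delta>(2)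
    by (simp add: m_def a_def N_diff_commute)
  then have degQ: "degree Q = m"
    using a Q(2) le_degree[of Q m] by (force simp: m_def)
  have close: "N (poly P y - poly Q y) \<le> e" if "N y \<le> \<rho>" for y
  proof -
    have "coeffs_le \<rho> (\<delta> * \<rho> ^ m) (P - Q)"
      using Q \<rho>(1) by (intro coeffs_leI degree_diff_le) (auto simp: m_def less_imp_le)
    then show ?thesis
      using N_poly_le[of \<rho> _ "P - Q" y] that \<rho>(1) \<delta>(3) by force
  qed
  obtain c where c: "c \<in> T" "poly Q c = 0" "N (lead_coeff Q) * N (x - c) ^ degree Q \<le> N (poly Q x)"
    by (rule nearest_root[OF assms(1) root Q(1)]) (use degQ assms(4) m_def in auto)
  have "N (poly Q x) \<le> max (N (poly P x)) e"
    using close[OF \<rho>(2)] N_diff_le[of "poly P x" "poly P x - poly Q x"] by simp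
  then have bound: "a * N (x - c) ^ m \<le> max (N (poly P x)) e"
    using c(3) by (simp add: lead degQ)
  then have "N (x - c) ^ m \<le> B"
    using a by (simp add: B_def pos_le_divide_eq mult.commute)
  also have "B \<le> \<rho> ^ m"
    using \<rho> assms(4) self_le_power[of \<rho> m] by (simp add: m_def)
  finally have "N (x - c) \<le> \<rho>"
    using power_mono_iff[of "N (x - c)" \<rho> m] \<rho>(1) assms(4) N_nonneg by (simp add: m_def)
  then have "N c \<le> \<rho>"
    using \<rho>(2) by (metis N_diff_commute N_le_of_diff_le)
  then have "N (poly P c) \<le> e"
    using close[of c] c(2) by simp
  then show thesis
    using that bound by (simp add: a_def m_def)
qed

text \<open>
  Approximate roots \<open>x\<^sub>n\<close> with \<open>|P(x\<^sub>n)|\<close> decreasing geometrically can be chosen so that each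
  lies close to its predecessor, hence they converge to a root.
\<close>

lemma root_in_completion:
  assumes "subfield_set T"
    and "\<forall>q. (\<forall>i. coeff q i \<in> T) \<and> degree q > 0 \<longrightarrow> (\<exists>x\<in>T. poly q x = 0)"
    and "\<forall>x. \<forall>e>0. \<exists>y\<in>T. N (x - y) < e"
    and complete: "Metric_space.mcomplete UNIV (norm_dist N)"
    and "degree (P :: 'a poly) > 0"
  shows "\<exists>x. poly P x = 0"
proof -
  define m where "m = degree P"
  define a where "a = N (lead_coeff P)"
  have a: "0 < a"
    unfolding a_def by (rule N_pos) (use assms(5) in auto)
  \<comment> \<open>The power \<open>m\<close> is undone by an m-th root:
    \<open>a * N (x n - x (Suc n)) ^ m \<le> e n\<close> says that the n-th step has size at most
    \<open>(1 / 2) ^ n\<close>.\<close>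
  define e where "e n = a * ((1 / 2) ^ n) ^ m" for n
  have e: "0 < e n" for n
    using a by (simp add: e_def)
  have e_decr: "e (Suc n) \<le> e n" for n
    unfolding e_def using a by (intro mult_left_mono power_mono power_decreasing) auto
  note approx = approximate_root[OF assms(1-3) assms(5)]
  have "\<exists>x. \<forall>n. N (poly P (x n)) \<le> e n \<and> a * N (x n - x (Suc n)) ^ m \<le> e n"
  proof (rule dependent_nat_choice)
    show "\<exists>x. N (poly P x) \<le> e 0"
      by (rule approx[OF e[of 0]]) blast
    show "\<exists>y. N (poly P y) \<le> e (Suc n) \<and> a * N (x - y) ^ m \<le> e n"
      if "N (poly P x) \<le> e n" for x n
    proof -
      obtain y where y: "N (poly P y) \<le> e (Suc n)"
        "a * N (x - y) ^ m \<le> max (N (poly P x)) (e (Suc n))"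
        unfolding a_def m_def by (rule approx[OF e[of "Suc n"]])
      then show ?thesis
        using that e_decr[of n] by (intro exI[of _ y]) auto
    qed
  qed
  then obtain x where x: "\<And>n. N (poly P (x n)) \<le> e n"
    "\<And>n. a * N (x n - x (Suc n)) ^ m \<le> e n"
    by blast
  have "N (x (Suc n) - x n) \<le> 1 * (1 / 2) ^ n" for n
    using x(2)[of n] a assms(5) power_mono_iff[of "N (x n - x (Suc n))" "(1 / 2) ^ n" m] N_nonneg
    by (simp add: e_def m_def N_diff_commute)
  then obtain l where l: "\<And>n. N (l - x n) \<le> 1 * (1 / 2) ^ n"
    using geometric_limit[OF complete, of "1 / 2" x 1] by auto
  define \<rho> where "\<rho> = max 1 (N l)"
  have \<rho>: "1 \<le> \<rho>" "N l \<le> \<rho>"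
    by (auto simp: \<rho>_def)
  obtain M where M: "coeffs_le \<rho> M P"
    by (rule coeffs_le_exists)
  have "N (x n) \<le> \<rho>" for n
  proof (rule N_le_of_diff_le[OF _ \<rho>(2)])
    have "N (x n - l) \<le> (1 / 2) ^ n"
      using l[of n] by (simp add: N_diff_commute)
    also have "\<dots> \<le> 1"
      by (simp add: power_le_one)
    finally show "N (x n - l) \<le> \<rho>"
      using \<rho>(1) by linarith
  qed
  then have "\<rho> * N (poly P l - poly P (x n)) \<le> M * N (l - x n)" for n
    using N_poly_diff_le[OF _ M \<rho>(2)] \<rho>(1) by simp
  moreover have "N (poly P l - poly P (x n)) \<le> \<rho> * N (poly P l - poly P (x n))" for n
    using mult_right_mono[OF \<rho>(1) N_nonneg] by simp
  moreover have "M * N (l - x n) \<le> M * (1 / 2) ^ n" for n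
    using l[of n] coeffs_le_nonneg[OF M] by (intro mult_left_mono) auto
  ultimately have *: "N (poly P l - poly P (x n)) \<le> M * (1 / 2) ^ n" for n
    by (meson order_trans)
  have e_le: "e n \<le> a * (1 / 2) ^ n" for n
    using a assms(5) power_decreasing[of 1 m "(1 / 2 :: real) ^ n"]
    by (simp add: e_def m_def power_le_one)
  have "N (poly P l) \<le> (M + a) * (1 / 2) ^ n" for n
  proof (rule N_le_of_diff_le)
    have "M * (1 / 2) ^ n \<le> (M + a) * (1 / 2) ^ n" "a * (1 / 2) ^ n \<le> (M + a) * (1 / 2) ^ n"
      using coeffs_le_nonneg[OF M] a by (auto intro!: mult_right_mono)
    then show "N (poly P l - poly P (x n)) \<le> (M + a) * (1 / 2) ^ n"
      "N (poly P (x n)) \<le> (M + a) * (1 / 2) ^ n"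
      using *[of n] x(1)[of n] e_le[of n] by linarith+
  qed
  moreover have "(\<lambda>n. (M + a) * (1 / 2) ^ n) \<longlonglongrightarrow> 0"
    by (rule tendsto_mult_right_zero, rule LIMSEQ_power_zero) simp
  ultimately have "N (poly P l) \<le> 0"
    using LIMSEQ_le_const by blast
  then show ?thesis
    using N_nonneg[of "poly P l"] N_eq_0_iff by force
qed

end

text \<open>The dynamical argument uses the p-adic field only through these properties. The last one
  provides points arbitrarily close to a given point.\<close>

locale complete_alg_closed_norm = ultrametric_norm N
  for N :: "'a::field \<Rightarrow> real" +
  assumes complete: "Metric_space.mcomplete UNIV (norm_dist N)"
    and alg_closed: "degree (q :: 'a poly) > 0 \<Longrightarrow> \<exists>x. poly q x = 0"
    and nontrivial: "\<exists>x. x \<noteq> 0 \<and> N x < 1"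

lemma (in padic_complex_field) complete_alg_closed_norm:
  assumes "prime p"
  shows "complete_alg_closed_norm N"
proof
  obtain T S where S: "algebraic_closure_of S T" and T: "completion_of N T UNIV"
    using tower by blast
  interpret Metric_space UNIV "norm_dist N"
    by (rule Metric_space_norm_dist)
  show complete: "Metric_space.mcomplete UNIV (norm_dist N)"
    using T by (simp add: completion_of_def)
  have subfield: "subfield_set T"
    using T by (simp add: completion_of_def)
  have "mtopology closure_of T = UNIV"
    using T by (simp add: completion_of_def)
  then have dense: "\<forall>x. \<forall>e>0. \<exists>y\<in>T. N (x - y) < e"
    by (auto simp: metric_closure_of norm_dist_def)
  show "\<exists>x. poly q x = 0" if "degree q > 0" for q :: "'a poly"
  proof (rule root_in_completion[OF subfield _ dense complete that])
    show "\<forall>q. (\<forall>i. coeff q i \<in> T) \<and> degree q > 0 \<longrightarrow> (\<exists>x\<in>T. poly q x = 0)"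
      using S by (simp add: algebraic_closure_of_def)
  qed
  have "1 < p"
    using assms by (rule prime_gt_1_nat)
  have quotient: "quotient_of (of_nat p) = (int p, 1)"
    using quotient_of_int[of "int p"] by (simp add: Rat.of_int_def)
  have "multiplicity (int p) (int p) = 1"
    using \<open>1 < p\<close> by (intro multiplicity_self) auto
  then have "padic_abs p (of_nat p) = real p powi - 1"
    using \<open>1 < p\<close> by (simp add: padic_abs_def quotient)
  then have "N (of_nat p) = 1 / real p"
    using N_of_rat[of "of_nat p"] by (simp add: power_int_minus divide_inverse)
  then have "N (of_nat p) < 1"
    using \<open>1 < p\<close> by simp
  then show "\<exists>x. x \<noteq> 0 \<and> N x < 1"
    using \<open>1 < p\<close> by (intro exI[of _ "of_nat p"]) auto
qed

section \<open>Fatou and Julia sets\<close>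

lemma poly_map_funpow: "(poly_map g ^^ n) (Fin z) = Fin ((poly g ^^ n) z)"
  by (induction n) auto

lemma poly_map_funpow_Infty: "(poly_map g ^^ n) Infty = Infty"
  by (induction n) auto

context ultrametric_norm
begin

section \<open>Comparison of the chordal metric with the norm\<close>

lemma chordal_le: "chordal N (Fin z) (Fin w) \<le> N (z - w)"
proof -
  have "1 * 1 \<le> max (N z) 1 * max (N w) 1"
    by (intro mult_mono) auto
  then have "N (z - w) * 1 \<le> N (z - w) * (max (N z) 1 * max (N w) 1)"
    by (intro mult_left_mono) (auto simp: N_nonneg)
  then show ?thesis
    by (simp add: divide_le_eq less_max_iff_disj)
qed

text \<open>Only \<open>z\<close> has to be bounded: if |w| > R, then |w| \<le> |z - w|, which
  compensates the growth of the denominator.\<close>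

lemma chordal_ge:
  assumes "N z \<le> R" "1 \<le> R" "0 < e" "e \<le> 1" "e \<le> N (z - w)"
  shows "e / R\<^sup>2 \<le> chordal N (Fin z) (Fin w)"
proof -
  have "e * N w \<le> R * N (z - w)"
  proof (cases "N w \<le> R")
    case True
    then have "N w * e \<le> R * N (z - w)"
      using assms by (intro mult_mono) auto
    then show ?thesis
      by (simp add: mult.commute)
  next
    case False
    then have "N w \<le> N (z - w)"
      using N_diff_le[of z "z - w"] assms(1) by auto
    then show ?thesis
      using assms N_nonneg by (intro mult_mono) auto
  qed
  moreover have "e * 1 \<le> R * N (z - w)"
    using assms mult_mono[of 1 R e "N (z - w)"] by simp
  ultimately have *: "e * max (N w) 1 \<le> R * N (z - w)"
    by (auto simp: max_def)
  have z: "max (N z) 1 \<le> R" "0 < max (N z) 1" "0 < max (N w) 1"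
    using assms by (auto simp: less_max_iff_disj)
  have "max (N z) 1 * (e * max (N w) 1) \<le> R * (R * N (z - w))"
    using z assms(2,3) by (intro mult_mono[OF z(1) *]) auto
  then have "e * (max (N z) 1 * max (N w) 1) \<le> N (z - w) * R\<^sup>2"
    by (simp add: power2_eq_square ac_simps)
  then show ?thesis
    using z assms(2) by (simp add: divide_le_eq pos_le_divide_eq mult_pos_pos)
qed

lemma chordal_lessE:
  assumes "chordal N (Fin z) v < e / R\<^sup>2" "N z \<le> R" "1 \<le> R" "0 < e" "e \<le> 1"
  obtains w where "v = Fin w" "N (z - w) < e"
proof (cases v)
  case (Fin w)
  then show thesis
    using that chordal_ge[OF assms(2-5), of w] assms(1) by force
next
  case Infty
  have "e / R\<^sup>2 \<le> 1 / R"
    using assms by (simp add: power2_eq_square divide_le_eq)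
  also have "\<dots> \<le> 1 / max (N z) 1"
    using assms by (intro divide_left_mono mult_pos_pos) (auto simp: less_max_iff_disj)
  finally show thesis
    using assms(1) Infty by simp
qed

text \<open>Near a finite point the norm can replace the chordal metric for the starting points, but
  not for the iterates, which may be unbounded.\<close>

lemma iterates_equicontinuous_at_Fin:
  "iterates_equicontinuous_at N (poly_map g) (Fin z) \<longleftrightarrow>
    (\<forall>\<epsilon>>0. \<exists>\<delta>>0. \<forall>w. N (z - w) < \<delta> \<longrightarrow>
      (\<forall>n. chordal N (Fin ((poly g ^^ n) z)) (Fin ((poly g ^^ n) w)) < \<epsilon>))"
    (is "_ \<longleftrightarrow> ?R")
proof
  assume *: "iterates_equicontinuous_at N (poly_map g) (Fin z)"
  show ?R
  proof (intro allI impI)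
    fix \<epsilon> :: real
    assume "0 < \<epsilon>"
    then obtain \<delta> where "0 < \<delta>" and \<delta>: "\<And>v n. chordal N (Fin z) v < \<delta> \<Longrightarrow>
        chordal N ((poly_map g ^^ n) (Fin z)) ((poly_map g ^^ n) v) < \<epsilon>"
      using * unfolding iterates_equicontinuous_at_def by metis
    then show "\<exists>\<delta>>0. \<forall>w. N (z - w) < \<delta> \<longrightarrow>
        (\<forall>n. chordal N (Fin ((poly g ^^ n) z)) (Fin ((poly g ^^ n) w)) < \<epsilon>)"
      using chordal_le order_le_less_trans by (metis poly_map_funpow)
  qed
next
  assume *: ?R
  show "iterates_equicontinuous_at N (poly_map g) (Fin z)"
    unfolding iterates_equicontinuous_at_def
  proof (intro allI impI)
    fix \<epsilon> :: real
    assume "0 < \<epsilon>"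
    then obtain \<delta> where "0 < \<delta>" and \<delta>: "\<And>w n. N (z - w) < \<delta> \<Longrightarrow>
        chordal N (Fin ((poly g ^^ n) z)) (Fin ((poly g ^^ n) w)) < \<epsilon>"
      using * by metis
    define \<eta> where "\<eta> = min \<delta> 1 / (max (N z) 1)\<^sup>2"
    have "\<eta> > 0"
      using \<open>0 < \<delta>\<close> by (auto simp: \<eta>_def less_max_iff_disj)
    moreover have "chordal N ((poly_map g ^^ n) (Fin z)) ((poly_map g ^^ n) v) < \<epsilon>"
      if v: "chordal N (Fin z) v < \<eta>" for v n
    proof -
      obtain w where "v = Fin w" "N (z - w) < min \<delta> 1"
        by (rule chordal_lessE[OF v[unfolded \<eta>_def]]) (use \<open>0 < \<delta>\<close> in auto)
      then show ?thesis
        using \<delta>[of w n] by (simp add: poly_map_funpow)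
    qed
    ultimately show "\<exists>\<delta>>0. \<forall>w. chordal N (Fin z) w < \<delta> \<longrightarrow>
        (\<forall>n. chordal N ((poly_map g ^^ n) (Fin z)) ((poly_map g ^^ n) w) < \<epsilon>)"
      by blast
  qed
qed

lemma openin_proj_topology:
  "openin (proj_topology N) U \<longleftrightarrow> (\<forall>a\<in>U. \<exists>r>0. \<forall>b. chordal N a b < r \<longrightarrow> b \<in> U)"
proof -
  interpret Metric_space UNIV "chordal N"
    by (rule Metric_space_chordal)
  show ?thesis
    unfolding proj_topology_def openin_mtopology by (auto simp: subset_iff)
qed

lemma openin_fatou: "openin (proj_topology N) (fatou N g)"
  unfolding fatou_def by (rule openin_Union) blast

lemma fatou_equicontinuous: "a \<in> fatou N g \<Longrightarrow> iterates_equicontinuous_at N (poly_map g) a"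
  unfolding fatou_def by blast

lemma fatouI:
  "openin (proj_topology N) U \<Longrightarrow> (\<And>b. b \<in> U \<Longrightarrow> iterates_equicontinuous_at N (poly_map g) b)
    \<Longrightarrow> a \<in> U \<Longrightarrow> a \<in> fatou N g"
  unfolding fatou_def by blast

lemma fatou_ball:
  assumes "Fin z \<in> fatou N g"
  obtains e where "0 < e" "\<And>w. N (z - w) < e \<Longrightarrow> Fin w \<in> fatou N g"
proof -
  obtain r where "0 < r" "\<And>b. chordal N (Fin z) b < r \<Longrightarrow> b \<in> fatou N g"
    using openin_fatou assms unfolding openin_proj_topology by meson
  then show thesis
    using that chordal_le order_le_less_trans by metis
qed

lemma fatou_ballI:
  assumes "0 < e"
    and "\<And>w. N (z - w) < e \<Longrightarrow> iterates_equicontinuous_at N (poly_map g) (Fin w)"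
  shows "Fin z \<in> fatou N g"
proof (rule fatouI)
  let ?U = "Fin ` {w. N (z - w) < e}"
  show "openin (proj_topology N) ?U"
    unfolding openin_proj_topology
  proof
    fix a
    assume "a \<in> ?U"
    then obtain x where x: "a = Fin x" "N (z - x) < e"
      by blast
    define \<eta> where "\<eta> = min e 1 / (max (N x) 1)\<^sup>2"
    have "b \<in> ?U" if b: "chordal N a b < \<eta>" for b
    proof -
      obtain w where "b = Fin w" "N (x - w) < min e 1"
        by (rule chordal_lessE[OF b[unfolded x(1) \<eta>_def]]) (use assms(1) in auto)
      then show ?thesis
        using x(2) N_diff_ultra[of z w x] by auto
    qed
    moreover have "\<eta> > 0"
      using assms(1) by (auto simp: \<eta>_def less_max_iff_disj)
    ultimately show "\<exists>r>0. \<forall>b. chordal N a b < r \<longrightarrow> b \<in> ?U"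
      by blast
  qed
  show "iterates_equicontinuous_at N (poly_map g) b" if "b \<in> ?U" for b
    using that assms(2) by blast
  show "Fin z \<in> ?U"
    using assms(1) by simp
qed

lemma julia_closed:
  assumes "\<And>e. 0 < e \<Longrightarrow> \<exists>y. Fin y \<in> julia N g \<and> N (z - y) < e"
  shows "Fin z \<in> julia N g"
proof (rule ccontr)
  assume "Fin z \<notin> julia N g"
  then obtain e where "0 < e" "\<And>w. N (z - w) < e \<Longrightarrow> Fin w \<in> fatou N g"
    using fatou_ball[of z g] by (auto simp: julia_def)
  then show False
    using assms[of e] by (auto simp: julia_def)
qed

lemma poly_continuous:
  assumes "0 < e"
  obtains \<delta> where "0 < \<delta>" "\<And>w. N (z - w) < \<delta> \<Longrightarrow> N (poly g z - poly g w) < e"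
proof -
  define \<rho> where "\<rho> = max (N z) 1"
  have \<rho>: "1 \<le> \<rho>" "N z \<le> \<rho>"
    by (auto simp: \<rho>_def)
  obtain M where M: "coeffs_le \<rho> M g"
    by (rule coeffs_le_exists)
  have M0: "0 \<le> M"
    by (rule coeffs_le_nonneg[OF M])
  show thesis
  proof (rule that[of "min 1 (e / (M + 1))"])
    show "0 < min 1 (e / (M + 1))"
      using M0 assms by simp
    fix w
    assume w: "N (z - w) < min 1 (e / (M + 1))"
    have "N w \<le> \<rho>"
      using N_diff_le[of z "z - w"] w \<rho> by auto
    have "1 * N (poly g z - poly g w) \<le> \<rho> * N (poly g z - poly g w)"
      using \<rho>(1) N_nonneg by (rule mult_right_mono)
    also have "\<dots> \<le> M * N (z - w)"
      using N_poly_diff_le[OF _ M \<rho>(2) \<open>N w \<le> \<rho>\<close>] \<rho>(1) by simp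
    also have "\<dots> \<le> (M + 1) * N (z - w)"
      using N_nonneg by (intro mult_right_mono) auto
    also have "\<dots> < e"
      using w M0 by (simp add: pos_less_divide_eq mult.commute)
    finally show "N (poly g z - poly g w) < e"
      by simp
  qed
qed

lemma equicontinuous_at_preimage:
  assumes "iterates_equicontinuous_at N (poly_map g) (Fin (poly g z))"
  shows "iterates_equicontinuous_at N (poly_map g) (Fin z)"
  unfolding iterates_equicontinuous_at_Fin
proof (intro allI impI)
  fix \<epsilon> :: real
  assume "0 < \<epsilon>"
  then obtain \<delta> where "0 < \<delta>" and \<delta>: "\<And>w n. N (poly g z - w) < \<delta> \<Longrightarrow>
      chordal N (Fin ((poly g ^^ n) (poly g z))) (Fin ((poly g ^^ n) w)) < \<epsilon>"
    using assms unfolding iterates_equicontinuous_at_Fin by metis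
  obtain \<eta> where "0 < \<eta>" and \<eta>: "\<And>w. N (z - w) < \<eta> \<Longrightarrow> N (poly g z - poly g w) < \<delta>"
    using poly_continuous[OF \<open>0 < \<delta>\<close>] by blast
  \<comment> \<open>The hypothesis at \<open>poly g z\<close> says nothing about the iterate
    \<open>n = 0\<close>; the bound \<open>\<epsilon>\<close> in the minimum takes care of
    it.\<close>
  have "chordal N (Fin ((poly g ^^ n) z)) (Fin ((poly g ^^ n) w)) < \<epsilon>"
    if w: "N (z - w) < min \<eta> \<epsilon>" for w n
  proof (cases n)
    case 0
    then show ?thesis
      using w chordal_le[of z w] by simp
  next
    case (Suc k)
    then show ?thesis
      using \<delta>[OF \<eta>, of w k] w by (simp only: funpow_Suc_right o_apply)
  qed
  then show "\<exists>\<delta>>0. \<forall>w. N (z - w) < \<delta> \<longrightarrow>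
      (\<forall>n. chordal N (Fin ((poly g ^^ n) z)) (Fin ((poly g ^^ n) w)) < \<epsilon>)"
    using \<open>0 < \<eta>\<close> \<open>0 < \<epsilon>\<close> by (intro exI[of _ "min \<eta> \<epsilon>"]) auto
qed

lemma fatou_preimage:
  assumes "Fin (poly g z) \<in> fatou N g"
  shows "Fin z \<in> fatou N g"
proof -
  obtain e where "0 < e" and e: "\<And>w. N (poly g z - w) < e \<Longrightarrow> Fin w \<in> fatou N g"
    using fatou_ball[OF assms] by blast
  obtain \<delta> where "0 < \<delta>" and \<delta>: "\<And>w. N (z - w) < \<delta> \<Longrightarrow> N (poly g z - poly g w) < e"
    using poly_continuous[OF \<open>0 < e\<close>] by blast
  then show ?thesis
    by (intro fatou_ballI[OF \<open>0 < \<delta>\<close>] equicontinuous_at_preimage[OF fatou_equicontinuous[OF e]])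
qed

section \<open>Dynamics near infinity\<close>

context
  fixes g :: "'a poly" and A B :: real
  assumes deg: "degree g \<ge> 2" and A: "A = N (lead_coeff g)"
    and B: "\<And>i. N (coeff g i) \<le> B" "1 \<le> B"
begin

lemma lead_pos: "0 < A"
  unfolding A by (rule N_pos) (use deg in auto)

lemma one_le_radius: "1 \<le> B / A"
  using B(1)[of "degree g"] A lead_pos by simp

lemma coeff_bound_outside:
  assumes "B / A < \<rho>" "i < degree g"
  shows "N (coeff g i) * \<rho> ^ i < A * \<rho> ^ degree g"
proof -
  have \<rho>: "1 < \<rho>"
    using assms(1) one_le_radius by simp
  have "N (coeff g i) * \<rho> ^ i \<le> B * \<rho> ^ i"
    using B(1) \<rho> by (intro mult_right_mono) auto
  also have "\<dots> < A * \<rho> * \<rho> ^ i"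
    using assms(1) lead_pos \<rho> by (intro mult_strict_right_mono) (auto simp: pos_divide_less_eq mult.commute)
  also have "\<dots> = A * \<rho> ^ Suc i"
    by simp
  also have "\<dots> \<le> A * \<rho> ^ degree g"
    using assms(2) lead_pos \<rho> by (intro mult_left_mono power_increasing) auto
  finally show ?thesis .
qed

lemma N_poly_outside:
  assumes "B / A < N z"
  shows "N (poly g z) = A * N z ^ degree g" "N z \<le> N (poly g z)"
proof -
  define \<rho> where "\<rho> = N z"
  have \<rho>: "1 < \<rho>" "B / A < \<rho>"
    using assms one_le_radius by (auto simp: \<rho>_def)
  define h where "h = monom (lead_coeff g) (degree g)"
  \<comment> \<open>A finite maximum keeps the strict inequality of
    \<open>coeff_bound_outside\<close>. Its term at \<open>degree g\<close> is 0, which also covers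
    all higher indices.\<close>
  define M where "M = Max ((\<lambda>i. N (coeff (g - h) i) * \<rho> ^ i) ` {..degree g})"
  have pos: "0 < A * \<rho> ^ degree g"
    using lead_pos \<rho> by simp
  have "coeffs_le \<rho> M (g - h)"
    unfolding coeffs_le_def
  proof
    fix i
    show "N (coeff (g - h) i) * \<rho> ^ i \<le> M"
    proof (cases "i \<le> degree g")
      case True
      then show ?thesis
        unfolding M_def by (intro Max_ge) auto
    next
      case False
      have "N (coeff (g - h) (degree g)) * \<rho> ^ degree g \<le> M"
        unfolding M_def by (intro Max_ge) auto
      then show ?thesis
        using False by (simp add: h_def coeff_eq_0)
    qed
  qed
  then have "N (poly (g - h) z) \<le> M"
    using \<rho> by (intro N_poly_le[of \<rho>]) (auto simp: \<rho>_def)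
  also have "M < A * \<rho> ^ degree g"
    unfolding M_def using coeff_bound_outside[OF \<rho>(2)] pos
    by (subst Max_less_iff) (auto simp: h_def le_less)
  also have "\<dots> = N (poly h z)"
    by (simp add: h_def poly_monom N_mult N_power A \<rho>_def)
  finally have "N (poly g z) = N (poly h z)"
    by (intro N_eq_of_diff_less) simp
  then show eq: "N (poly g z) = A * N z ^ degree g"
    by (simp add: h_def poly_monom N_mult N_power A)
  have "1 * \<rho> \<le> (A * \<rho>) * \<rho>"
    using \<rho> lead_pos B(2) by (intro mult_right_mono) (auto simp: pos_divide_less_eq mult.commute)
  also have "\<dots> = A * \<rho> ^ 2"
    by (simp add: power2_eq_square)
  also have "\<dots> \<le> A * \<rho> ^ degree g"
    using deg lead_pos \<rho> by (intro mult_left_mono power_increasing) auto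
  finally show "N z \<le> N (poly g z)"
    by (simp add: eq \<rho>_def)
qed

text \<open>Norms grow from \<open>\<rho>\<close> to \<open>\<sigma>\<close>, and differences by at
  most the factor \<open>\<sigma> / \<rho>\<close>, while the chordal denominators grow by the
  square of this factor.\<close>

lemma chordal_poly_outside:
  assumes "B / A < N z" "N w = N z"
  shows "chordal N (Fin (poly g z)) (Fin (poly g w)) \<le> chordal N (Fin z) (Fin w)"
proof -
  define \<rho> where "\<rho> = N z"
  define \<sigma> where "\<sigma> = A * \<rho> ^ degree g"
  have \<rho>: "1 < \<rho>" "B / A < \<rho>"
    using assms one_le_radius by (auto simp: \<rho>_def)
  have "coeffs_le \<rho> \<sigma> g"
    unfolding coeffs_le_def
  proof
    fix i
    show "N (coeff g i) * \<rho> ^ i \<le> \<sigma>"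
      using coeff_bound_outside[OF \<rho>(2), of i] lead_pos \<rho>
      by (cases i "degree g" rule: linorder_cases) (auto simp: \<sigma>_def A coeff_eq_0)
  qed
  then have diff: "\<rho> * N (poly g z - poly g w) \<le> \<sigma> * N (z - w)"
    using \<rho> assms by (intro N_poly_diff_le) (auto simp: \<rho>_def)
  have \<sigma>: "N (poly g z) = \<sigma>" "N (poly g w) = \<sigma>" "\<rho> \<le> \<sigma>"
    using N_poly_outside[of z] N_poly_outside[of w] assms by (auto simp: \<sigma>_def \<rho>_def)
  have "\<rho> * (\<rho> * N (poly g z - poly g w)) \<le> \<sigma> * (\<sigma> * N (z - w))"
    by (rule mult_mono[OF \<sigma>(3) diff]) (use \<rho> \<sigma>(3) N_nonneg in auto)
  then have "N (poly g z - poly g w) / (\<sigma> * \<sigma>) \<le> N (z - w) / (\<rho> * \<rho>)"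
    using \<rho> \<sigma>(3) by (simp add: divide_le_eq pos_le_divide_eq ac_simps)
  then show ?thesis
    using \<rho> \<sigma> assms(2) by (simp add: \<rho>_def max_def)
qed

lemma iterates_outside:
  assumes "B / A < N z" "N w = N z"
  shows "N z \<le> N ((poly g ^^ n) z) \<and> N ((poly g ^^ n) w) = N ((poly g ^^ n) z) \<and>
    chordal N (Fin ((poly g ^^ n) z)) (Fin ((poly g ^^ n) w)) \<le> chordal N (Fin z) (Fin w)"
proof (induction n)
  case 0
  then show ?case
    using assms by simp
next
  case (Suc n)
  let ?z = "(poly g ^^ n) z" and ?w = "(poly g ^^ n) w"
  have *: "B / A < N ?z" "B / A < N ?w"
    using assms(1) Suc.IH by auto
  show ?case
    using N_poly_outside[OF *(1)] N_poly_outside[OF *(2)] chordal_poly_outside[OF *(1)] Suc.IH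
    by force
qed

lemma equicontinuous_at_outside:
  assumes "B / A < N z"
  shows "iterates_equicontinuous_at N (poly_map g) (Fin z)"
  unfolding iterates_equicontinuous_at_Fin
proof (intro allI impI)
  fix \<epsilon> :: real
  assume "0 < \<epsilon>"
  have "chordal N (Fin ((poly g ^^ n) z)) (Fin ((poly g ^^ n) w)) < \<epsilon>"
    if "N (z - w) < min \<epsilon> 1" for w n
  proof -
    have "N w = N z"
      using N_eq_of_diff_less[of w z] that assms one_le_radius by (simp add: N_diff_commute)
    then show ?thesis
      using iterates_outside[OF assms, of w n] chordal_le[of z w] that
      by (simp del: chordal.simps)
  qed
  then show "\<exists>\<delta>>0. \<forall>w. N (z - w) < \<delta> \<longrightarrow>
      (\<forall>n. chordal N (Fin ((poly g ^^ n) z)) (Fin ((poly g ^^ n) w)) < \<epsilon>)"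
    using \<open>0 < \<epsilon>\<close> by (intro exI[of _ "min \<epsilon> 1"]) auto
qed

lemma fatou_outside:
  assumes "B / A < N z"
  shows "Fin z \<in> fatou N g"
proof (rule fatou_ballI[of 1])
  fix w
  assume "N (z - w) < 1"
  then have "N w = N z"
    using N_eq_of_diff_less[of w z] assms one_le_radius by (simp add: N_diff_commute)
  then show "iterates_equicontinuous_at N (poly_map g) (Fin w)"
    using assms by (intro equicontinuous_at_outside) simp
qed simp

lemma outside_near_Infty:
  assumes "chordal N Infty (Fin z) < A / B"
  shows "B / A < N z"
proof -
  have "0 < max (N z) 1"
    by (simp add: less_max_iff_disj)
  then have "B < A * max (N z) 1"
    using assms B(2) lead_pos by (simp add: field_simps)
  moreover have "A \<le> B"
    using one_le_radius lead_pos by (simp add: pos_le_divide_eq)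
  ultimately show ?thesis
    using lead_pos by (auto simp: max_def pos_divide_less_eq mult.commute split: if_splits)
qed

lemma equicontinuous_at_Infty: "iterates_equicontinuous_at N (poly_map g) Infty"
  unfolding iterates_equicontinuous_at_def
proof (intro allI impI)
  fix \<epsilon> :: real
  assume "0 < \<epsilon>"
  have "chordal N ((poly_map g ^^ n) Infty) ((poly_map g ^^ n) v) < \<epsilon>"
    if "chordal N Infty v < min \<epsilon> (A / B)" for v n
  proof (cases v)
    case (Fin z)
    have z: "B / A < N z"
      using that Fin by (intro outside_near_Infty) simp
    have "1 / max (N ((poly g ^^ n) z)) 1 \<le> 1 / max (N z) 1"
      using iterates_outside[OF z refl, of n] by (intro divide_left_mono) auto
    then show ?thesis
      using that Fin by (simp add: poly_map_funpow poly_map_funpow_Infty)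
  next
    case Infty
    then show ?thesis
      using \<open>0 < \<epsilon>\<close> by (simp add: poly_map_funpow_Infty)
  qed
  then show "\<exists>\<delta>>0. \<forall>w. chordal N Infty w < \<delta> \<longrightarrow>
      (\<forall>n. chordal N ((poly_map g ^^ n) Infty) ((poly_map g ^^ n) w) < \<epsilon>)"
    using \<open>0 < \<epsilon>\<close> B(2) lead_pos by (intro exI[of _ "min \<epsilon> (A / B)"]) auto
qed

lemma fatou_Infty: "Infty \<in> fatou N g"
proof (rule fatouI)
  let ?U = "insert Infty (fatou N g)"
  show "openin (proj_topology N) ?U"
    unfolding openin_proj_topology
  proof
    fix a
    assume a: "a \<in> ?U"
    show "\<exists>r>0. \<forall>b. chordal N a b < r \<longrightarrow> b \<in> ?U"
    proof (cases "a = Infty")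
      case True
      \<comment> \<open>Apart from \<open>Infty\<close>, the chordal ball of radius
        \<open>A / B\<close> around \<open>Infty\<close> consists of points of norm greater than
        \<open>B / A\<close>.\<close>
      have "b \<in> ?U" if "chordal N a b < A / B" for b
      proof (cases b)
        case (Fin z)
        then show ?thesis
          using that True outside_near_Infty fatou_outside by simp
      qed simp
      then show ?thesis
        using B(2) lead_pos by (intro exI[of _ "A / B"]) auto
    next
      case False
      then show ?thesis
        using a openin_fatou[of g] unfolding openin_proj_topology by (metis insert_iff)
    qed
  qed
  show "iterates_equicontinuous_at N (poly_map g) b" if "b \<in> ?U" for b
    using that equicontinuous_at_Infty fatou_equicontinuous by blast
qed simp

lemma julia_bounded: "Fin z \<in> julia N g \<Longrightarrow> N z \<le> B / A"
  using fatou_outside[of z] by (force simp: julia_def)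

end

end

section \<open>Complete invariance of the Julia set\<close>

context complete_alg_closed_norm
begin

text \<open>The three bounds serve, in this order, the openness of polynomial maps, the covering
  property of \<open>g\<close> near J(f), and preimages under \<open>f\<close>, where expansion is
  known only at the preimage \<open>c\<close>.\<close>

lemma nearest_preimage:
  assumes "degree g > 0"
  obtains c where "poly g c = y"
    "N (lead_coeff g) * N (z - c) ^ degree g \<le> N (poly g z - y)"
    "N (z - c) * N (poly (pderiv g) z) \<le> N (poly g z - y)"
    "N (z - c) * N (poly (pderiv g) c) \<le> N (poly g z - y)"
proof -
  define q where "q = g + [:- y:]"
  have "degree q = degree g"
    unfolding q_def using assms by (intro degree_add_eq_left) simp
  moreover have "lead_coeff q = lead_coeff g"
    unfolding q_def using assms by (intro lead_coeff_add_le[of "[:- y:]" g, simplified add.commute]) simp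
  moreover have "pderiv q = pderiv g"
    by (simp add: q_def pderiv_add pderiv_pCons)
  moreover obtain c where "poly q c = 0"
    "N (lead_coeff q) * N (z - c) ^ degree q \<le> N (poly q z)"
    "N (z - c) * N (poly (pderiv q) z) \<le> N (poly q z)"
    "N (z - c) * N (poly (pderiv q) c) \<le> N (poly q z)"
    by (rule nearest_root[of UNIV q z])
      (use assms \<open>degree q = degree g\<close> alg_closed in \<open>auto simp: subfield_set_def\<close>)
  ultimately show thesis
    using that[of c] by (simp add: q_def)
qed

lemma poly_open:
  assumes "degree g > 0" "0 < \<delta>"
  obtains e where "0 < e" "\<And>y. N (poly g z - y) < e \<Longrightarrow> \<exists>c. poly g c = y \<and> N (z - c) < \<delta>"
proof (rule that)
  have a: "0 < N (lead_coeff g)"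
    by (rule N_pos) (use assms(1) in auto)
  then show "0 < N (lead_coeff g) * \<delta> ^ degree g"
    using assms(2) by simp
  fix y
  assume "N (poly g z - y) < N (lead_coeff g) * \<delta> ^ degree g"
  then obtain c where "poly g c = y" "N (lead_coeff g) * N (z - c) ^ degree g
      < N (lead_coeff g) * \<delta> ^ degree g"
    using nearest_preimage[OF assms(1), of y z] by (metis order_le_less_trans)
  then show "\<exists>c. poly g c = y \<and> N (z - c) < \<delta>"
    using a assms(2) by (intro exI[of _ c]) (auto intro: power_less_imp_less_base)
qed

text \<open>Openness lifts each point near \<open>poly g z\<close> to a point near \<open>z\<close>;
  the n-th iterate of the image is iterate \<open>Suc n\<close> of the lift.\<close>

lemma equicontinuous_at_image:
  assumes "degree g > 0" "iterates_equicontinuous_at N (poly_map g) (Fin z)"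
  shows "iterates_equicontinuous_at N (poly_map g) (Fin (poly g z))"
  unfolding iterates_equicontinuous_at_Fin
proof (intro allI impI)
  fix \<epsilon> :: real
  assume "0 < \<epsilon>"
  then obtain \<delta> where "0 < \<delta>" and \<delta>: "\<And>w n. N (z - w) < \<delta> \<Longrightarrow>
      chordal N (Fin ((poly g ^^ n) z)) (Fin ((poly g ^^ n) w)) < \<epsilon>"
    using assms(2) unfolding iterates_equicontinuous_at_Fin by metis
  obtain e where "0 < e" and e: "\<And>y. N (poly g z - y) < e \<Longrightarrow> \<exists>c. poly g c = y \<and> N (z - c) < \<delta>"
    using poly_open[OF assms(1) \<open>0 < \<delta>\<close>] by blast
  have "chordal N (Fin ((poly g ^^ n) (poly g z))) (Fin ((poly g ^^ n) y)) < \<epsilon>"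
    if "N (poly g z - y) < e" for y n
    using e[OF that] \<delta>[of _ "Suc n"] by (auto simp del: funpow.simps simp: funpow_Suc_right)
  then show "\<exists>\<delta>>0. \<forall>w. N (poly g z - w) < \<delta> \<longrightarrow>
      (\<forall>n. chordal N (Fin ((poly g ^^ n) (poly g z))) (Fin ((poly g ^^ n) w)) < \<epsilon>)"
    using \<open>0 < e\<close> by blast
qed

lemma fatou_image:
  assumes "degree g > 0" "Fin z \<in> fatou N g"
  shows "Fin (poly g z) \<in> fatou N g"
proof -
  obtain \<delta> where "0 < \<delta>" and \<delta>: "\<And>w. N (z - w) < \<delta> \<Longrightarrow> Fin w \<in> fatou N g"
    using fatou_ball[OF assms(2)] by blast
  obtain e where "0 < e" and e: "\<And>y. N (poly g z - y) < e \<Longrightarrow> \<exists>c. poly g c = y \<and> N (z - c) < \<delta>"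
    using poly_open[OF assms(1) \<open>0 < \<delta>\<close>] by blast
  show ?thesis
  proof (rule fatou_ballI[OF \<open>0 < e\<close>])
    fix y
    assume "N (poly g z - y) < e"
    then obtain c where "poly g c = y" "N (z - c) < \<delta>"
      using e by blast
    then show "iterates_equicontinuous_at N (poly_map g) (Fin y)"
      using equicontinuous_at_image[OF assms(1)] fatou_equicontinuous \<delta> by blast
  qed
qed

lemma julia_poly_iff:
  "degree g > 0 \<Longrightarrow> Fin (poly g z) \<in> julia N g \<longleftrightarrow> Fin z \<in> julia N g"
  using fatou_image[of g z] fatou_preimage[of g z] by (auto simp: julia_def)

end

section \<open>Shadowing\<close>

context ultrametric_norm
begin

context
  fixes \<phi> :: "'a \<Rightarrow> 'a" and y :: "nat \<Rightarrow> 'a" and \<mu> :: "nat \<Rightarrow> real" and r \<kappa> :: real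
  assumes r: "0 < r" and \<kappa>: "1 < \<kappa>"
    and scale: "\<And>k u v. N (u - y k) \<le> r \<Longrightarrow> N (v - y k) \<le> r \<Longrightarrow> N (\<phi> u - \<phi> v) = \<mu> k * N (u - v)"
    and \<mu>: "\<And>k. \<kappa> \<le> \<mu> k"
begin

text \<open>Here \<open>y\<close> need not be an orbit of \<open>\<phi>\<close>: below, an
  \<open>f\<close>-orbit is used with the maps \<open>f\<close> and \<open>g\<close>, and a
  \<open>g\<close>-orbit with the map \<open>f\<close>. Closeness is required only for
  \<open>k < n\<close>, so the formula still holds at the first time at which the orbits
  separate.\<close>

lemma scaling_iterates:
  assumes "\<And>k. k < n \<Longrightarrow> N ((\<phi> ^^ k) u - y k) \<le> r" "\<And>k. k < n \<Longrightarrow> N ((\<phi> ^^ k) v - y k) \<le> r"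
  shows "N ((\<phi> ^^ n) u - (\<phi> ^^ n) v) = (\<Prod>k<n. \<mu> k) * N (u - v)"
  using assms
proof (induction n)
  case (Suc n)
  then show ?case
    using scale[of "(\<phi> ^^ n) u" n "(\<phi> ^^ n) v"] by (simp add: ac_simps)
qed simp

lemma multiplier_prod_ge: "\<kappa> ^ n \<le> (\<Prod>k<n. \<mu> k)"
  using prod_mono[of "{..<n}" "\<lambda>_. \<kappa>" \<mu>] \<kappa> \<mu> by simp

lemma shadowing_close:
  assumes "\<And>k. k \<le> n \<Longrightarrow> N ((\<phi> ^^ k) u - y k) \<le> r" "\<And>k. k \<le> n \<Longrightarrow> N ((\<phi> ^^ k) v - y k) \<le> r"
  shows "N (u - v) \<le> r * (1 / \<kappa>) ^ n"
proof -
  have "\<kappa> ^ n * N (u - v) \<le> (\<Prod>k<n. \<mu> k) * N (u - v)"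
    using multiplier_prod_ge N_nonneg by (rule mult_right_mono)
  also have "\<dots> = N ((\<phi> ^^ n) u - (\<phi> ^^ n) v)"
    using assms by (intro scaling_iterates[symmetric]) auto
  also have "\<dots> \<le> r"
    using assms[of n] by (metis N_diff_commute N_diff_le_trans order_refl)
  finally show ?thesis
    using \<kappa> by (simp add: power_one_over field_simps)
qed

lemma geometric_tendsto_0: "(\<lambda>n. r * (1 / \<kappa>) ^ n) \<longlonglongrightarrow> 0"
  by (rule tendsto_mult_right_zero, rule LIMSEQ_power_zero) (use \<kappa> in auto)

lemma shadowing_unique:
  assumes "\<And>k. N ((\<phi> ^^ k) u - y k) \<le> r" "\<And>k. N ((\<phi> ^^ k) v - y k) \<le> r"
  shows "u = v"
proof -
  have "N (u - v) \<le> r * (1 / \<kappa>) ^ n" for n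
    by (rule shadowing_close) (use assms in auto)
  then have "N (u - v) \<le> 0"
    using geometric_tendsto_0 LIMSEQ_le_const by blast
  then show ?thesis
    using N_nonneg[of "u - v"] N_eq_0_iff[of "u - v"] by simp
qed

text \<open>This takes the place of a compactness argument: points that shadow for longer and longer
  times form a Cauchy sequence by \<open>shadowing_close\<close>.\<close>

lemma shadowing_limit:
  assumes complete: "Metric_space.mcomplete UNIV (norm_dist N)"
    and closed: "\<And>x. (\<And>e. 0 < e \<Longrightarrow> \<exists>y\<in>S. N (x - y) < e) \<Longrightarrow> x \<in> S"
    and approx: "\<And>n. \<exists>x\<in>S. \<forall>k\<le>n. N ((\<phi> ^^ k) x - y k) \<le> r"
  shows "\<exists>x\<in>S. \<forall>k. N ((\<phi> ^^ k) x - y k) \<le> r"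
proof -
  obtain x where x: "\<And>n. x n \<in> S" "\<And>n k. k \<le> n \<Longrightarrow> N ((\<phi> ^^ k) (x n) - y k) \<le> r"
    using approx by metis
  have "N (x (Suc n) - x n) \<le> r * (1 / \<kappa>) ^ n" for n
    by (rule shadowing_close) (use x in auto)
  then obtain l where l: "\<And>n. N (l - x n) \<le> r * (1 / \<kappa>) ^ n"
    using geometric_limit[OF complete, of "1 / \<kappa>" x r] \<kappa> by auto
  have lim0: "(\<lambda>n. N (l - x n)) \<longlonglongrightarrow> 0"
    using l N_nonneg by (intro tendsto_sandwich[OF _ _ tendsto_const geometric_tendsto_0]) auto
  have "l \<in> S"
  proof (rule closed)
    fix e :: real
    assume "0 < e"
    then have "\<forall>\<^sub>F n in sequentially. N (l - x n) < e"
      using lim0 order_tendstoD(2) by blast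
    then show "\<exists>y\<in>S. N (l - y) < e"
      using x(1) eventually_happens'[OF sequentially_bot] by blast
  qed
  \<comment> \<open>Convergence of the k-th iterates places the k-th iterate of \<open>l\<close>
    within \<open>r\<close> of \<open>y k\<close>. There the scaling law applies and carries
    convergence over to \<open>Suc k\<close>, in place of continuity of
    \<open>\<phi>\<close>.\<close>
  moreover have near: "N ((\<phi> ^^ k) l - y k) \<le> r"
    if lim: "(\<lambda>n. N ((\<phi> ^^ k) l - (\<phi> ^^ k) (x n))) \<longlonglongrightarrow> 0" for k
  proof -
    have "\<forall>\<^sub>F n in sequentially. N ((\<phi> ^^ k) l - (\<phi> ^^ k) (x n)) < r \<and> k \<le> n"
      using order_tendstoD(2)[OF lim r] eventually_ge_at_top[of k] by (rule eventually_conj)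
    then obtain n where "N ((\<phi> ^^ k) l - (\<phi> ^^ k) (x n)) < r" "k \<le> n"
      using eventually_happens'[OF sequentially_bot] by blast
    then show ?thesis
      using x(2)[of k n] N_diff_le_trans[of "(\<phi> ^^ k) l" "(\<phi> ^^ k) (x n)" r] by simp
  qed
  moreover have "(\<lambda>n. N ((\<phi> ^^ k) l - (\<phi> ^^ k) (x n))) \<longlonglongrightarrow> 0" for k
  proof (induction k)
    case 0
    then show ?case
      using lim0 by simp
  next
    case (Suc k)
    have "\<forall>\<^sub>F n in sequentially.
        \<mu> k * N ((\<phi> ^^ k) l - (\<phi> ^^ k) (x n)) = N ((\<phi> ^^ Suc k) l - (\<phi> ^^ Suc k) (x n))"
      using eventually_ge_at_top[of k]
    proof eventually_elim
      case (elim n)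
      then show ?case
        using scale[OF near[OF Suc.IH] x(2)[of k n]] by simp
    qed
    moreover have "(\<lambda>n. \<mu> k * N ((\<phi> ^^ k) l - (\<phi> ^^ k) (x n))) \<longlonglongrightarrow> 0"
      by (rule tendsto_mult_right_zero[OF Suc.IH])
    ultimately show ?case
      by (rule Lim_transform_eventually[rotated])
  qed
  ultimately show ?thesis
    by blast
qed

end

end

text \<open>In the application \<open>J\<close> is the Julia set of \<open>f\<close> and \<open>e z = |f'(z)|\<close>.\<close>

locale expanding_perturbation = ultrametric_norm N
  for N :: "'a::field \<Rightarrow> real" +
  fixes f g :: "'a \<Rightarrow> 'a" and J :: "'a set" and e :: "'a \<Rightarrow> real" and r \<kappa> :: real
  assumes complete: "Metric_space.mcomplete UNIV (norm_dist N)"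
    and r: "0 < r" and \<kappa>: "1 < \<kappa>"
    and invariant: "z \<in> J \<Longrightarrow> f z \<in> J"
    and expanding: "z \<in> J \<Longrightarrow> \<kappa> \<le> e z"
    and scale_f: "z \<in> J \<Longrightarrow> N (u - z) \<le> r \<Longrightarrow> N (v - z) \<le> r \<Longrightarrow> N (f u - f v) = e z * N (u - v)"
    and scale_g: "z \<in> J \<Longrightarrow> N (u - z) \<le> r \<Longrightarrow> N (v - z) \<le> r \<Longrightarrow> N (g u - g v) = e z * N (u - v)"
    and covering: "z \<in> J \<Longrightarrow> N (y - f z) \<le> r \<Longrightarrow> \<exists>x. g x = y \<and> N (x - z) \<le> r"
begin

lemma invariant_funpow: "z \<in> J \<Longrightarrow> (f ^^ n) z \<in> J"
  by (induction n) (auto simp: invariant)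

text \<open>Finite shadows are built backwards, since expansion makes preimages stay close: a point
  shadowing the orbit of \<open>f z\<close> for \<open>n\<close> steps has a
  \<open>g\<close>-preimage near \<open>z\<close> by \<open>covering\<close>.\<close>

lemma shadow_exists:
  assumes "z \<in> J"
  shows "\<exists>w. \<forall>k. N ((g ^^ k) w - (f ^^ k) z) \<le> r"
proof -
  have "\<exists>w. \<forall>k\<le>n. N ((g ^^ k) w - (f ^^ k) z) \<le> r" if "z \<in> J" for n z
    using that
  proof (induction n arbitrary: z)
    case 0
    then show ?case
      using r by (intro exI[of _ z]) simp
  next
    case (Suc n)
    obtain w' where w': "\<And>k. k \<le> n \<Longrightarrow> N ((g ^^ k) w' - (f ^^ k) (f z)) \<le> r"
      using Suc.IH[OF invariant[OF Suc.prems]] by blast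
    then obtain w where w: "g w = w'" "N (w - z) \<le> r"
      using covering[OF Suc.prems, of w'] by force
    have "N ((g ^^ k) w - (f ^^ k) z) \<le> r" if "k \<le> Suc n" for k
      using that w w' by (cases k) (auto simp del: funpow.simps simp: funpow_Suc_right)
    then show ?case
      by blast
  qed
  from this[OF assms] have "\<exists>w\<in>UNIV. \<forall>k. N ((g ^^ k) w - (f ^^ k) z) \<le> r"
    using invariant_funpow[OF assms] scale_g expanding
    by (intro shadowing_limit[where \<mu> = "\<lambda>k. e ((f ^^ k) z)", OF r \<kappa> _ _ complete]) auto
  then show ?thesis
    by blast
qed

lemma shadow_unique:
  assumes "z \<in> J" "\<And>k. N ((g ^^ k) u - (f ^^ k) z) \<le> r" "\<And>k. N ((g ^^ k) v - (f ^^ k) z) \<le> r"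
  shows "u = v"
  using assms invariant_funpow[OF assms(1)] scale_g expanding
  by (intro shadowing_unique[where \<mu> = "\<lambda>k. e ((f ^^ k) z)" and y = "\<lambda>k. (f ^^ k) z", OF r \<kappa>]) auto

definition shadow :: "'a \<Rightarrow> 'a" where
  "shadow z = (SOME w. \<forall>k. N ((g ^^ k) w - (f ^^ k) z) \<le> r)"

lemma N_shadow_le: "z \<in> J \<Longrightarrow> N ((g ^^ k) (shadow z) - (f ^^ k) z) \<le> r"
  unfolding shadow_def using someI_ex[OF shadow_exists] by blast

lemma shadow_eqI: "z \<in> J \<Longrightarrow> (\<And>k. N ((g ^^ k) w - (f ^^ k) z) \<le> r) \<Longrightarrow> shadow z = w"
  using shadow_unique N_shadow_le by blast

lemma shadow_conjugates:
  assumes "z \<in> J"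
  shows "shadow (f z) = g (shadow z)"
proof (rule shadow_eqI[OF invariant[OF assms]])
  show "N ((g ^^ k) (g (shadow z)) - (f ^^ k) (f z)) \<le> r" for k
    using N_shadow_le[OF assms, of "Suc k"] by (simp only: funpow_Suc_right o_apply)
qed

text \<open>
  Up to the first time at which the orbits of \<open>z\<close> and \<open>z'\<close> are more than \<open>r\<close> apart, \<open>f\<close> and \<open>g\<close>
  stretch both distances by the same factors, and at that time the distances agree by the
  ultrametric inequality.
\<close>

lemma shadow_isometry:
  assumes z: "z \<in> J" and z': "z' \<in> J"
  shows "N (shadow z - shadow z') = N (z - z')"
proof (cases "\<forall>k. N ((f ^^ k) z' - (f ^^ k) z) \<le> r")
  case True
  \<comment> \<open>Both orbits stay near the orbit of \<open>z\<close>, so uniqueness applies to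
    the map \<open>f\<close> itself.\<close>
  have "z' = z"
    using True r invariant_funpow[OF z] scale_f expanding
    by (intro shadowing_unique[where \<mu> = "\<lambda>k. e ((f ^^ k) z)" and y = "\<lambda>k. (f ^^ k) z", OF r \<kappa>]) auto
  then show ?thesis
    by simp
next
  case False
  then obtain n where n: "\<not> N ((f ^^ n) z' - (f ^^ n) z) \<le> r"
    and near: "\<And>k. k < n \<Longrightarrow> N ((f ^^ k) z' - (f ^^ k) z) \<le> r"
    using exists_least_iff[of "\<lambda>k. \<not> N ((f ^^ k) z' - (f ^^ k) z) \<le> r"] by blast
  define P where "P = (\<Prod>k<n. e ((f ^^ k) z))"
  have "0 < P"
    unfolding P_def using expanding[OF invariant_funpow[OF z]] \<kappa>
    by (intro prod_pos) (metis less_le_trans less_trans zero_less_one)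
  have "N ((f ^^ n) z - (f ^^ n) z') = P * N (z - z')"
    unfolding P_def using near r invariant_funpow[OF z] scale_f expanding
    by (intro scaling_iterates[where y = "\<lambda>k. (f ^^ k) z", OF r \<kappa>]) auto
  \<comment> \<open>Before time \<open>n\<close> the orbit of \<open>shadow z'\<close> is within
    \<open>r\<close> of the orbit of \<open>z\<close> as well, by comparison with the orbit of
    \<open>z'\<close>.\<close>
  moreover have "N ((g ^^ n) (shadow z) - (g ^^ n) (shadow z')) = P * N (shadow z - shadow z')"
    unfolding P_def using invariant_funpow[OF z] scale_g expanding N_shadow_le[OF z]
      N_diff_le_trans[OF N_shadow_le[OF z'] near]
    by (intro scaling_iterates[where y = "\<lambda>k. (f ^^ k) z", OF r \<kappa>]) auto
  moreover have "N ((g ^^ n) (shadow z) - (g ^^ n) (shadow z')) = N ((f ^^ n) z - (f ^^ n) z')"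
  proof (rule N_eq_of_diff_less)
    have "(g ^^ n) (shadow z) - (g ^^ n) (shadow z') - ((f ^^ n) z - (f ^^ n) z')
        = ((g ^^ n) (shadow z) - (f ^^ n) z) - ((g ^^ n) (shadow z') - (f ^^ n) z')"
      by simp
    also have "N \<dots> \<le> r"
      using N_diff_le N_shadow_le[OF z] N_shadow_le[OF z'] by (meson max.boundedI order_trans)
    also have "r < N ((f ^^ n) z - (f ^^ n) z')"
      using n by (simp add: N_diff_commute)
    finally show "N ((g ^^ n) (shadow z) - (g ^^ n) (shadow z') - ((f ^^ n) z - (f ^^ n) z'))
        < N ((f ^^ n) z - (f ^^ n) z')" .
  qed
  ultimately show ?thesis
    using \<open>0 < P\<close> by simp
qed

lemma shadow_surj:
  assumes closed: "\<And>x. (\<And>e. 0 < e \<Longrightarrow> \<exists>y\<in>J. N (x - y) < e) \<Longrightarrow> x \<in> J"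
    and nonempty: "J \<noteq> {}" and bounded: "\<And>z. z \<in> J \<Longrightarrow> N z \<le> R"
    and preimage: "\<And>x z. z \<in> J \<Longrightarrow> \<exists>c\<in>J. f c = z \<and> \<kappa> * N (x - c) \<le> N (f x - z)"
    and close: "\<And>x. N x \<le> R \<Longrightarrow> N (f x - g x) \<le> r"
    and orbit: "\<And>k. N ((g ^^ k) w) \<le> R"
  shows "\<exists>z\<in>J. shadow z = w"
proof -
  obtain z0 where z0: "z0 \<in> J"
    using nonempty by blast
  \<comment> \<open>Any point of \<open>J\<close> is within \<open>R\<close> of the end of the
    bounded orbit. One pullback turns an error s into at most max(r, s) / \<kappa>, so the
    perturbation error \<open>r\<close> does not accumulate and the initial error decays.\<close>
  have pull: "\<exists>c\<in>J. \<forall>k\<le>n. N ((g ^^ k) x - (f ^^ k) c) \<le> max r (R * (1 / \<kappa>) ^ (n - k))"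
    if "\<And>k. N ((g ^^ k) x) \<le> R" for n x
    using that
  proof (induction n arbitrary: x)
    case 0
    have "N (x - z0) \<le> R"
      using "0.prems"[of 0] bounded[OF z0] N_diff_le[of x z0] by simp
    then show ?case
      using z0 by (intro bexI[of _ z0]) auto
  next
    case (Suc n)
    have "N ((g ^^ k) (g x)) \<le> R" for k
      using Suc.prems[of "Suc k"] by (simp only: funpow_Suc_right o_apply)
    then obtain c' where c': "c' \<in> J"
      "\<And>k. k \<le> n \<Longrightarrow> N ((g ^^ k) (g x) - (f ^^ k) c') \<le> max r (R * (1 / \<kappa>) ^ (n - k))"
      using Suc.IH by blast
    obtain c where c: "c \<in> J" "f c = c'" "\<kappa> * N (x - c) \<le> N (f x - c')"
      using preimage[OF c'(1)] by blast
    have "N (f x - g x) \<le> max r (R * (1 / \<kappa>) ^ n)" "N (g x - c') \<le> max r (R * (1 / \<kappa>) ^ n)"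
      using close[of x] Suc.prems[of 0] c'(2)[of 0] by auto
    then have "N (f x - c') \<le> max r (R * (1 / \<kappa>) ^ n)"
      by (rule N_diff_le_trans)
    then have "\<kappa> * N (x - c) \<le> max r (R * (1 / \<kappa>) ^ n)"
      using c(3) by linarith
    also have "\<dots> \<le> max (\<kappa> * r) (\<kappa> * (R * (1 / \<kappa>) ^ Suc n))"
      using \<kappa> r by (intro max.mono) auto
    also have "\<dots> = \<kappa> * max r (R * (1 / \<kappa>) ^ Suc n)"
      using \<kappa> by (simp add: max_mult_distrib_left)
    finally have "N (x - c) \<le> max r (R * (1 / \<kappa>) ^ Suc n)"
      using \<kappa> by simp
    then have "N ((g ^^ k) x - (f ^^ k) c) \<le> max r (R * (1 / \<kappa>) ^ (Suc n - k))"
      if "k \<le> Suc n" for k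
      using that c(2) c'(2)[of "k - 1"]
      by (cases k) (auto simp del: funpow.simps(2) power_Suc simp: funpow_Suc_right)
    then show ?case
      using c(1) by blast
  qed
  have "(\<lambda>n. R * (1 / \<kappa>) ^ n) \<longlonglongrightarrow> 0"
    by (rule tendsto_mult_right_zero, rule LIMSEQ_power_zero) (use \<kappa> in auto)
  then have "\<forall>\<^sub>F n in sequentially. R * (1 / \<kappa>) ^ n < r"
    using r order_tendstoD(2) by blast
  \<comment> \<open>Starting the pullback \<open>m\<close> steps later brings the error below
    \<open>r\<close> at all times up to \<open>n\<close>.\<close>
  then obtain m where m: "\<And>n. m \<le> n \<Longrightarrow> R * (1 / \<kappa>) ^ n < r"
    by (auto simp: eventually_sequentially)
  have approx: "\<exists>c\<in>J. \<forall>k\<le>n. N ((f ^^ k) c - (g ^^ k) w) \<le> r" for n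
  proof -
    obtain c where c: "c \<in> J"
      "\<And>k. k \<le> n + m \<Longrightarrow> N ((g ^^ k) w - (f ^^ k) c) \<le> max r (R * (1 / \<kappa>) ^ (n + m - k))"
      using pull[OF orbit] by blast
    have "N ((f ^^ k) c - (g ^^ k) w) \<le> r" if "k \<le> n" for k
    proof -
      have "R * (1 / \<kappa>) ^ (n + m - k) < r"
        by (rule m) (use that in arith)
      then show ?thesis
        using c(2)[of k] that by (simp add: N_diff_commute)
    qed
    then show ?thesis
      using c(1) by blast
  qed
  \<comment> \<open>No single \<open>f\<close>-orbit is known yet to follow the whole
    \<open>g\<close>-orbit. At each time the factor of \<open>f\<close> is read off at some nearby
    point of \<open>J\<close>, chosen separately.\<close>
  have "\<exists>c\<in>J. N (c - (g ^^ k) w) \<le> r" for k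
    using approx[of k] invariant_funpow by blast
  then obtain c where c: "\<And>k. c k \<in> J" "\<And>k. N (c k - (g ^^ k) w) \<le> r"
    by metis
  have scale: "N (f u - f v) = e (c k) * N (u - v)"
    if "N (u - (g ^^ k) w) \<le> r" "N (v - (g ^^ k) w) \<le> r" for k u v
    using that c(2)[of k] by (intro scale_f[OF c(1)]) (metis N_diff_commute N_diff_le_trans)+
  obtain z where z: "z \<in> J" "\<And>k. N ((f ^^ k) z - (g ^^ k) w) \<le> r"
    using shadowing_limit[where \<mu> = "\<lambda>k. e (c k)", OF r \<kappa> scale expanding[OF c(1)] complete closed approx]
    by blast
  then have "shadow z = w"
    by (intro shadow_eqI) (auto simp: N_diff_commute)
  then show ?thesis
    using z(1) by blast
qed

end

section \<open>Stability\<close>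

context ultrametric_norm
begin

text \<open>The topology sees only the coefficients up to \<open>d\<close>; the others vanish for
  both polynomials. As \<open>d > 0\<close> excludes the zero polynomial, the coefficient at
  \<open>d\<close> lies in the punctured factor.\<close>

lemma openin_coefficient_ball:
  assumes "d > 0" "degree f = d"
  shows "openin (poly_topology N d) {g. degree g = d \<and> (\<forall>i. N (coeff g i - coeff f i) < \<eta>)}"
proof (cases "0 < \<eta>")
  case True
  interpret Metric_space UNIV "norm_dist N"
    by (rule Metric_space_norm_dist)
  let ?X = "\<lambda>i. if i = d then subtopology (norm_topology N) (UNIV - {0}) else norm_topology N"
  let ?S = "\<lambda>i. if i = d then mball (coeff f i) \<eta> \<inter> (UNIV - {0}) else mball (coeff f i) \<eta>"
  have "openin (product_topology ?X {..d}) (PiE {..d} ?S)"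
    unfolding openin_PiE[OF finite_atMost] norm_topology_def
    by (auto simp: openin_subtopology_Int)
  moreover have "{g. degree g = d \<and> (\<forall>i. N (coeff g i - coeff f i) < \<eta>)}
      = (\<lambda>g. restrict (coeff g) {..d}) -` PiE {..d} ?S \<inter> {g. degree g = d}"
    (is "?L = ?R")
  proof (intro set_eqI iffI)
    fix g
    assume "g \<in> ?L"
    then have "coeff g i \<in> ?S i" if "i \<le> d" for i
      using assms leading_coeff_0_iff[of g] by (auto simp: norm_dist_def N_diff_commute)
    then show "g \<in> ?R"
      using \<open>g \<in> ?L\<close> by (auto simp: PiE_iff simp del: in_mball)
  next
    fix g
    assume g: "g \<in> ?R"
    have "N (coeff g i - coeff f i) < \<eta>" for i
    proof (cases "i \<le> d")
      case i: True
      then have "coeff g i \<in> ?S i"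
        using g by (force simp: PiE_iff simp del: in_mball)
      then show ?thesis
        by (auto simp: norm_dist_def N_diff_commute split: if_splits)
    next
      case False
      then show ?thesis
        using g assms(2) True by (auto simp: coeff_eq_0)
    qed
    then show "g \<in> ?L"
      using g by auto
  qed
  ultimately show ?thesis
    unfolding poly_topology_def openin_pullback_topology by blast
next
  case False
  then have "\<not> N (coeff g i - coeff f i) < \<eta>" for g i
    using N_nonneg[of "coeff g i - coeff f i"] by linarith
  then show ?thesis
    by simp
qed

lemma chordal_isometry_homeomorphic_map:
  assumes "h ` S = T" "\<And>a b. a \<in> S \<Longrightarrow> b \<in> S \<Longrightarrow> chordal N (h a) (h b) = chordal N a b"
  shows "homeomorphic_map (subtopology (proj_topology N) S) (subtopology (proj_topology N) T) h"
proof -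
  interpret Metric_space UNIV "chordal N"
    by (rule Metric_space_chordal)
  interpret S: Submetric UNIV "chordal N" S
    by unfold_locales simp
  interpret T: Submetric UNIV "chordal N" T
    by unfold_locales simp
  interpret ST: Metric_space12 S "chordal N" T "chordal N"
    by unfold_locales
  show ?thesis
    using ST.isometry_imp_homeomorphic_map[OF assms]
    by (simp add: proj_topology_def S.mtopology_submetric T.mtopology_submetric)
qed

end

context complete_alg_closed_norm
begin

section \<open>Perturbations of an immediately expanding polynomial\<close>

lemma small_nonzero:
  assumes "0 < \<delta>"
  obtains x where "x \<noteq> 0" "N x < \<delta>"
proof -
  obtain t where t: "t \<noteq> 0" "N t < 1"
    using nontrivial by blast
  then obtain n where "N t ^ n < \<delta>"
    using real_arch_pow_inv[OF assms] by blast
  then show thesis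
    using that[of "t ^ n"] t by (simp add: N_power)
qed

lemma immediately_expanding_perturbation:
  assumes deg: "degree f \<ge> 2" and exp: "immediately_expanding N f"
  obtains \<eta> where "0 < \<eta>"
    "\<And>g. degree g = degree f \<Longrightarrow> (\<And>i. N (coeff g i - coeff f i) < \<eta>) \<Longrightarrow>
      \<exists>h. homeomorphic_map (subtopology (proj_topology N) (julia N f))
            (subtopology (proj_topology N) (julia N g)) h \<and>
          (\<forall>z\<in>julia N f. h (poly_map f z) = poly_map g (h z))"
proof -
  define d where "d = degree f"
  define A where "A = N (lead_coeff f)"
  obtain M where "coeffs_le 1 M f"
    by (rule coeffs_le_exists)
  \<comment> \<open>With \<open>B \<ge> 1\<close> and \<open>\<eta> \<le> 1\<close> the perturbed
    coefficients are still bounded by \<open>B\<close>, so the same radius \<open>R\<close> works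
    for \<open>g\<close>.\<close>
  define B where "B = max 1 M"
  have B: "N (coeff f i) \<le> B" "1 \<le> B" for i
    using \<open>coeffs_le 1 M f\<close> by (auto simp: coeffs_le_def B_def le_max_iff_disj)
  have A: "0 < A"
    using lead_pos[OF deg A_def B] .
  define R where "R = B / A"
  have R: "1 \<le> R"
    unfolding R_def by (rule one_le_radius[OF deg A_def B])
  \<comment> \<open>\<open>C\<close> bounds the Gauss norms of \<open>f\<close> and \<open>g\<close>
    on D(0, R). With \<open>C * r = 1\<close> the Taylor remainder on D(z, r) is at most |u -
    v|.\<close>
  define C where "C = B * R ^ d"
  have Rd: "1 \<le> R ^ d"
    using R by (rule one_le_power)
  have C: "1 \<le> C"
    unfolding C_def using mult_mono[OF B(2) Rd] B(2) by simp
  define r where "r = 1 / C"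
  have rad: "0 < r" "r \<le> 1" "C * r = 1"
    using C by (auto simp: r_def)
  \<comment> \<open>The bound \<open>A\<close> preserves the norm of the leading coefficient;
    \<open>r / R ^ d\<close> gives |f - g| \<le> r on D(0, R).\<close>
  define \<eta> where "\<eta> = min A (r / R ^ d)"
  have \<eta>: "0 < \<eta>" "\<eta> \<le> A" "\<eta> * R ^ d \<le> r" "\<eta> \<le> 1"
  proof -
    show "0 < \<eta>" "\<eta> \<le> A"
      using A rad Rd by (auto simp: \<eta>_def)
    have "\<eta> \<le> r / R ^ d"
      by (simp add: \<eta>_def)
    then show "\<eta> * R ^ d \<le> r"
      using Rd by (simp add: pos_le_divide_eq)
    have "r / R ^ d \<le> 1"
      using rad(2) Rd by (simp add: divide_le_eq)
    then show "\<eta> \<le> 1"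
      by (simp add: \<eta>_def)
  qed
  define J where "J = {z. Fin z \<in> julia N f}"
  obtain \<kappa> where deriv_ge: "1 < \<kappa>" "\<And>z. z \<in> J \<Longrightarrow> \<kappa> \<le> N (poly (pderiv f) z)"
    using exp unfolding immediately_expanding_def J_def by blast
  have julia_f: "julia N f = Fin ` J"
  proof -
    have "Infty \<notin> julia N f"
      using fatou_Infty[OF deg A_def B] by (simp add: julia_def)
    then show ?thesis
      unfolding J_def by (auto simp: image_iff) (metis proj_line.exhaust)
  qed
  have J_bounded: "N z \<le> R" if "z \<in> J" for z
    using that julia_bounded[OF deg A_def B] by (simp add: J_def R_def)
  have J_iff: "poly f z \<in> J \<longleftrightarrow> z \<in> J" for z
    using deg by (simp add: J_def julia_poly_iff)
  have J_ne: "J \<noteq> {}"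
    using exp julia_f by (auto simp: immediately_expanding_def)
  have J_closed: "x \<in> J" if "\<And>e. 0 < e \<Longrightarrow> \<exists>y\<in>J. N (x - y) < e" for x
    unfolding J_def mem_Collect_eq by (rule julia_closed) (use that in \<open>auto simp: J_def\<close>)
  have near_J: "N u \<le> R" if "z \<in> J" "N (u - z) \<le> r" for u z
    using N_le_of_diff_le[of u z R] that J_bounded[of z] rad(2) R by auto
  have deriv: "N (poly (pderiv (q - f)) z) \<le> 1"
    if "degree q = d" "\<And>i. N (coeff q i - coeff f i) < \<eta>" "z \<in> J" for q z
  proof -
    have "coeffs_le R (\<eta> * R ^ d) (q - f)"
      using that R by (intro coeffs_leI degree_diff_le) (auto simp: d_def less_imp_le)
    then have "R * N (poly (pderiv (q - f)) z) \<le> \<eta> * R ^ d"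
      using R J_bounded[OF that(3)] by (intro N_pderiv_le) auto
    moreover have "1 * N (poly (pderiv (q - f)) z) \<le> R * N (poly (pderiv (q - f)) z)"
      using R N_nonneg by (intro mult_right_mono) auto
    ultimately show ?thesis
      using \<eta>(3) rad(2) by linarith
  qed
  \<comment> \<open>A general \<open>q\<close> covers \<open>f\<close> and \<open>g\<close> with the
    same factor. The Taylor remainder and the correction from q' to f' are each at most |u - v|,
    strictly less than the linear term.\<close>
  have scale: "N (poly q u - poly q v) = N (poly (pderiv f) z) * N (u - v)"
    if q: "degree q = d" "\<And>i. N (coeff q i) \<le> B" "\<And>i. N (coeff q i - coeff f i) < \<eta>"
      and z: "z \<in> J" "N (u - z) \<le> r" "N (v - z) \<le> r" for q u v z
  proof (cases "u = v")
    case False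
    define D where "D = N (u - v)"
    have D: "0 < D"
      unfolding D_def using False by (intro N_pos) simp
    have zR: "N z \<le> R"
      by (rule J_bounded[OF z(1)])
    have "R\<^sup>2 * N (poly q u - poly q v - (u - v) * poly (pderiv q) z) \<le> C * D * r"
      unfolding D_def using R z zR near_J[OF z(1)] coeffs_leI[of q d R B] q(1,2)
      by (intro N_poly_taylor_le) (auto simp: C_def)
    moreover have "C * D * r = (C * r) * D"
      by simp
    then have "C * D * r = D"
      using rad(3) by simp
    moreover have "1 * N (poly q u - poly q v - (u - v) * poly (pderiv q) z)
        \<le> R\<^sup>2 * N (poly q u - poly q v - (u - v) * poly (pderiv q) z)"
      using R N_nonneg by (intro mult_right_mono) auto
    ultimately have 1: "N (poly q u - poly q v - (u - v) * poly (pderiv q) z) \<le> D"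
      using \<open>C * D * r = D\<close> by linarith
    have "N ((u - v) * poly (pderiv (q - f)) z) \<le> D"
      using D deriv[OF q(1,3) z(1)] by (simp add: N_mult D_def)
    with 1 have "N ((poly q u - poly q v - (u - v) * poly (pderiv q) z)
        + (u - v) * poly (pderiv (q - f)) z) \<le> D"
      using N_ultra by (meson max.boundedI order_trans)
    then have "N (poly q u - poly q v - (u - v) * poly (pderiv f) z) \<le> D"
      by (simp add: pderiv_diff algebra_simps)
    also have "D * 1 < D * N (poly (pderiv f) z)"
      using deriv_ge(1) deriv_ge(2)[OF z(1)] D by (intro mult_strict_left_mono) auto
    then have "D < N ((u - v) * poly (pderiv f) z)"
      by (simp add: N_mult D_def)
    finally have "N (poly q u - poly q v) = N ((u - v) * poly (pderiv f) z)"
      by (rule N_eq_of_diff_less)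
    then show ?thesis
      by (simp add: N_mult)
  qed simp
  show thesis
  proof (rule that[OF \<eta>(1)])
    fix g
    assume deg_g: "degree g = degree f" and coeffs: "\<And>i. N (coeff g i - coeff f i) < \<eta>"
    have deg_g2: "degree g \<ge> 2"
      using deg deg_g by simp
    have Bg: "N (coeff g i) \<le> B" for i
      using N_le_of_diff_le[of "coeff g i" "coeff f i" B] coeffs[of i] \<eta>(4) B by auto
    have Ag: "A = N (lead_coeff g)"
      using N_eq_of_diff_less[of "lead_coeff g" "lead_coeff f"] coeffs[of d] \<eta>(2) deg_g
      by (simp add: d_def A_def)
    have close: "N (poly f x - poly g x) \<le> r" if "N x \<le> R" for x
    proof -
      have "coeffs_le R (\<eta> * R ^ d) (g - f)"
        using coeffs R deg_g by (intro coeffs_leI degree_diff_le) (auto simp: d_def less_imp_le)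
      then have "N (poly (g - f) x) \<le> \<eta> * R ^ d"
        using R that by (intro N_poly_le[of R]) auto
      then show ?thesis
        using \<eta>(3) by (simp add: N_diff_commute)
    qed
    have scale_g: "N (poly g u - poly g v) = N (poly (pderiv f) z) * N (u - v)"
      if "z \<in> J" "N (u - z) \<le> r" "N (v - z) \<le> r" for u v z
      using scale[of g] that coeffs Bg deg_g by (simp add: d_def)
    have deriv_g: "N (poly (pderiv g) z) = N (poly (pderiv f) z)" if "z \<in> J" for z
    proof (rule N_eq_of_diff_less)
      have "N (poly (pderiv g) z - poly (pderiv f) z) \<le> 1"
        using deriv[of g z] that coeffs deg_g by (simp add: d_def pderiv_diff)
      then show "N (poly (pderiv g) z - poly (pderiv f) z) < N (poly (pderiv f) z)"
        using deriv_ge(1) deriv_ge(2)[OF that] by linarith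
    qed
    interpret expanding_perturbation N "poly f" "poly g" J "\<lambda>z. N (poly (pderiv f) z)" r \<kappa>
    proof
      show "\<exists>x. poly g x = y \<and> N (x - z) \<le> r" if z: "z \<in> J" and y: "N (y - poly f z) \<le> r" for y z
      proof -
        obtain c where c: "poly g c = y" "N (z - c) * N (poly (pderiv g) z) \<le> N (poly g z - y)"
          using nearest_preimage[of g y z] deg_g2 by auto
        \<comment> \<open>Since |g'(z)| > 1, the preimage of \<open>y\<close> nearest to
          \<open>z\<close> is at most as far from \<open>z\<close> as \<open>y\<close> is from
          \<open>poly g z\<close>.\<close>
        have "N (z - c) * 1 \<le> N (z - c) * N (poly (pderiv g) z)"
          using deriv_ge deriv_g z N_nonneg by (intro mult_left_mono) force+
        also have "\<dots> \<le> N (poly g z - y)"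
          by (rule c(2))
        also have "\<dots> \<le> r"
          using N_diff_le_trans[of "poly g z" "poly f z" r y] y close[OF J_bounded[OF z]]
          by (simp add: N_diff_commute)
        finally show ?thesis
          using c(1) by (intro exI[of _ c]) (simp add: N_diff_commute)
      qed
    qed (use complete rad deriv_ge J_iff scale[of f] B \<eta>(1) scale_g in \<open>auto simp: d_def\<close>)
    have shadow_le: "N (shadow z - z) \<le> r" if "z \<in> J" for z
      using N_shadow_le[OF that, of 0] by simp
    have shadow_julia: "Fin (shadow z) \<in> julia N g" if z: "z \<in> J" for z
    proof (rule ccontr)
      assume "Fin (shadow z) \<notin> julia N g"
      then have "iterates_equicontinuous_at N (poly_map g) (Fin (shadow z))"
        using fatou_equicontinuous by (auto simp: julia_def)
      \<comment> \<open>By \<open>chordal_ge\<close>, a chordal distance below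
        \<open>r / R\<^sup>2\<close> from a point of D(0, R) forces a norm distance below
        \<open>r\<close>; then the orbit of \<open>w\<close> shadows that of \<open>z\<close>
        too.\<close>
      moreover have "0 < r / R\<^sup>2"
        using rad R by simp
      ultimately obtain \<delta> where "0 < \<delta>" and \<delta>: "\<And>w n. N (shadow z - w) < \<delta> \<Longrightarrow>
          chordal N (Fin ((poly g ^^ n) (shadow z))) (Fin ((poly g ^^ n) w)) < r / R\<^sup>2"
        unfolding iterates_equicontinuous_at_Fin by meson
      obtain t where t: "t \<noteq> 0" "N t < \<delta>"
        using small_nonzero[OF \<open>0 < \<delta>\<close>] by blast
      define w where "w = shadow z + t"
      have "N ((poly g ^^ n) w - (poly f ^^ n) z) \<le> r" for n
      proof -
        let ?s = "(poly g ^^ n) (shadow z)"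
        have s: "N (?s - (poly f ^^ n) z) \<le> r"
          by (rule N_shadow_le[OF z])
        have "N ?s \<le> R"
          by (rule near_J[OF invariant_funpow[OF z] s])
        then have "N (?s - (poly g ^^ n) w) < r"
          using chordal_ge[of ?s R r "(poly g ^^ n) w"] \<delta>[of w n] R rad t(2)
          by (force simp: w_def simp del: chordal.simps)
        then show ?thesis
          using s N_diff_le_trans[of "(poly g ^^ n) w" ?s r] by (simp add: N_diff_commute)
      qed
      then have "shadow z = w"
        by (rule shadow_eqI[OF z])
      then show False
        using t(1) by (simp add: w_def)
    qed
    have shadow_onto: "\<exists>z\<in>J. shadow z = w" if w: "Fin w \<in> julia N g" for w
    proof (rule shadow_surj[OF J_closed J_ne J_bounded])
      show "\<exists>c\<in>J. poly f c = z \<and> \<kappa> * N (x - c) \<le> N (poly f x - z)" if z: "z \<in> J" for x z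
      proof -
        obtain c where c: "poly f c = z" "N (x - c) * N (poly (pderiv f) c) \<le> N (poly f x - z)"
          using nearest_preimage[of f z x] deg by auto
        have "c \<in> J"
          using J_iff[of c] c(1) z by simp
        then have "\<kappa> * N (x - c) \<le> N (poly (pderiv f) c) * N (x - c)"
          by (intro mult_right_mono deriv_ge(2) N_nonneg)
        then show ?thesis
          using c \<open>c \<in> J\<close> by (intro bexI[of _ c]) (auto simp: mult.commute)
      qed
      \<comment> \<open>J(g) is invariant and lies in the same disk, as \<open>g\<close> shares the
        constants \<open>A\<close> and \<open>B\<close> with \<open>f\<close>.\<close>
      show "N ((poly g ^^ k) w) \<le> R" for k
      proof -
        have "Fin ((poly g ^^ k) w) \<in> julia N g"
          using w deg_g2 by (induction k) (simp_all add: julia_poly_iff)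
        then show ?thesis
          unfolding R_def by (rule julia_bounded[OF deg_g2 Ag Bg B(2)])
      qed
    qed (use close in auto)
    have julia_g: "julia N g = Fin ` shadow ` J"
    proof -
      have "Infty \<notin> julia N g"
        using fatou_Infty[OF deg_g2 Ag Bg B(2)] by (simp add: julia_def)
      then have "a \<in> Fin ` shadow ` J" if "a \<in> julia N g" for a
        using that shadow_onto by (cases a) blast+
      then show ?thesis
        using shadow_julia by blast
    qed
    \<comment> \<open>The value at \<open>Infty\<close> is a default; neither Julia set contains
      \<open>Infty\<close>.\<close>
    define h where "h a = (case a of Fin z \<Rightarrow> Fin (shadow z) | Infty \<Rightarrow> Infty)" for a
    have h_Fin: "h (Fin z) = Fin (shadow z)" for z
      by (simp add: h_def)
    \<comment> \<open>Because \<open>r \<le> 1\<close>, the shadow keeps the chordal denominators,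
      so an isometry for the norm is one for the chordal metric.\<close>
    have max_shadow: "max (N (shadow z)) 1 = max (N z) 1" if "z \<in> J" for z
    proof (cases "N z \<le> 1")
      case True
      then have "N (shadow z) \<le> 1"
        using N_le_of_diff_le[of "shadow z" z 1] shadow_le[OF that] rad(2) by auto
      then show ?thesis
        using True by simp
    next
      case False
      then have "N (shadow z) = N z"
        using shadow_le[OF that] rad(2) by (intro N_eq_of_diff_less) auto
      then show ?thesis
        by simp
    qed
    have "homeomorphic_map (subtopology (proj_topology N) (julia N f))
        (subtopology (proj_topology N) (julia N g)) h"
      unfolding julia_f julia_g
      by (rule chordal_isometry_homeomorphic_map)
        (auto simp: h_Fin image_image max_shadow shadow_isometry)
    moreover have "h (poly_map f a) = poly_map g (h a)" if "a \<in> julia N f" for a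
      using that shadow_conjugates by (auto simp: julia_f h_Fin)
    ultimately show "\<exists>h. homeomorphic_map (subtopology (proj_topology N) (julia N f))
            (subtopology (proj_topology N) (julia N g)) h \<and>
          (\<forall>z\<in>julia N f. h (poly_map f z) = poly_map g (h z))"
      by blast
  qed
qed

end

theorem theorem1p1:
  fixes p d :: nat and N :: "'a::field_char_0 \<Rightarrow> real" and f :: "'a poly"
  assumes "prime p"
    and "padic_complex_field p N"
    and "d \<ge> 2"
    and "degree f = d"
    and "immediately_expanding N f"
  shows "J_stable N d f"
proof -
  interpret padic_complex_field p N
    by (rule assms(2))
  interpret complete_alg_closed_norm N
    by (rule complete_alg_closed_norm[OF assms(1)])
  obtain \<eta> where \<eta>: "0 < \<eta>"
    "\<And>g. degree g = degree f \<Longrightarrow> (\<And>i. N (coeff g i - coeff f i) < \<eta>) \<Longrightarrow>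
      \<exists>h. homeomorphic_map (subtopology (proj_topology N) (julia N f))
            (subtopology (proj_topology N) (julia N g)) h \<and>
          (\<forall>z\<in>julia N f. h (poly_map f z) = poly_map g (h z))"
    by (rule immediately_expanding_perturbation[of f]) (use assms in auto)
  have "openin (poly_topology N d) {g. degree g = d \<and> (\<forall>i. N (coeff g i - coeff f i) < \<eta>)}"
    using assms by (intro openin_coefficient_ball) auto
  then show ?thesis
    unfolding J_stable_def
    by (intro exI conjI) (use \<eta> assms(4) in auto)
qed

end
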